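(* Let $\Omega\subset\mathbb{R}^n$ be a connected open set and let $u\in C^1(\Omega)$ be a real-valued function such that $\mathrm{D}u:\Omega\to\mathbb{R}^n$ is locally injective. For $x_0\in\Omega$ let $$u_{x_0}(x)= u(x)-u(x_0)-\langle \mathrm{D}u(x_0),x-x_0\rangle ,\qquad x\in\Omega.$$ Then, for every $k\in\{0,\dots,n\}$, the critical group $C_k(u_{x_0},x_0)$ is independent of $x_0\in\Omega$.
   Context: A continuous map $f:\Omega\to\mathbb{R}^n$ is locally injective if every $x\in\Omega$ has a neighborhood $\Omega'\subseteq\Omega$ such that $f|_{\Omega'}$ is injective. Critical groups: for $v\in C^1(\Omega)$, $x_0\in\Omega$, $c=v(x_0)$, a neighborhood $U\subseteq\Omega$ of $x_0$ (a set containing some ball $B_\delta(x_0)$, $\delta>0$), and $k\in\{0,\dots,n\}$, $$C_k(v,x_0)= H_k\big(\{v\le c\}\cap U,\ (\{v\le c\}\cap U)\setminus\{x_0\}\big),$$ where $H_k(X,A)$ is relative singular homology with integer coefficients. By excision this does not depend on $U$ up to isomorphism; equalities between critical groups (and hence "independent of $x_0$") are understood up to group isomorphism. *)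

theory Defs
  imports "HOL-Analysis.Analysis" "HOL-Homology.Homology"
begin

text \<open>Unique wherever \<open>f\<close> is differentiable; unspecified elsewhere.\<close>

definition grad :: "('a::real_inner \<Rightarrow> real) \<Rightarrow> 'a \<Rightarrow> 'a" where
  "grad f x = (THE D. GDERIV f x :> D)"

text \<open>Intended for open \<open>\<Omega>\<close>, since derivatives are taken in the full space.\<close>

definition C1_on :: "'a::euclidean_space set \<Rightarrow> ('a \<Rightarrow> real) \<Rightarrow> bool" where
  "C1_on \<Omega> f \<longleftrightarrow> (\<forall>x\<in>\<Omega>. f differentiable (at x)) \<and> continuous_on \<Omega> (grad f)"

definition locally_injective_on ::
    "'a::topological_space set \<Rightarrow> ('a \<Rightarrow> 'b::topological_space) \<Rightarrow> bool" where
  "locally_injective_on \<Omega> f \<longleftrightarrow>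
     continuous_on \<Omega> f \<and> (\<forall>x\<in>\<Omega>. \<exists>W\<subseteq>\<Omega>. x \<in> interior W \<and> inj_on f W)"

text \<open>The first-order Taylor remainder \<open>u\<^bsub>x0\<^esub>\<close> of \<open>u\<close> at \<open>x0\<close>.\<close>

definition taylor_remainder :: "('a::real_inner \<Rightarrow> real) \<Rightarrow> 'a \<Rightarrow> 'a \<Rightarrow> real" where
  "taylor_remainder u x0 x = u x - u x0 - grad u x0 \<bullet> (x - x0)"

text \<open>
  The neighbourhood \<open>U\<close> of \<open>x0\<close> is kept as an explicit parameter: different choices give
  isomorphic, but not equal, groups. Homology has integer coefficients.
\<close>

definition critical_group ::
    "nat \<Rightarrow> ('a::topological_space \<Rightarrow> real) \<Rightarrow> 'a \<Rightarrow> 'a set \<Rightarrow> 'a chain set monoid" where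
  "critical_group k v x0 U =
     relative_homology_group (int k)
       (top_of_set ({x. v x \<le> v x0} \<inter> U)) (({x. v x \<le> v x0} \<inter> U) - {x0})"

end

theory Submission
  imports Defs
begin

text \<open>
  For \<open>y\<close> near \<open>x0\<close>, the translated Taylor remainders \<open>f y z = u\<^bsub>y\<^esub> (y + z)\<close> have
  gradient \<open>Du (y + z) - Du y\<close>, so by local injectivity \<open>0\<close> is their only critical point in one
  common ball, and they depend continuously on \<open>y\<close> in the \<open>C\<^sup>1\<close> sense. The critical group is therefore
  locally constant by stability of a Gromoll-Meyer pair: on \<open>{g \<le> \<mu>}\<close>, where \<open>g\<close> is a large multiple of
  \<open>f x0\<close> plus the squared norm, descent directions point inwards, and
  \<open>H({f \<le> 0}, {f \<le> 0} - {0})\<close> agrees first with \<open>H({f \<le> \<gamma>}, {f \<le> -\<gamma>})\<close> and then with a pair of sublevel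
  sets of \<open>f x0\<close>. Since the gradient is merely continuous, gradient flows are replaced by
  infinite compositions of Euler steps; these converge also when the target level contains the
  critical point, because the distance travelled is controlled by the decrease of the function
  outside any given ball around that point.
\<close>

section \<open>Relative homology\<close>

text \<open>The inclusion of \<open>A\<close> into \<open>X\<close> is a homotopy equivalence with
  inverse \<open>H 1\<close>: one composite is homotopic to the identity through \<open>H\<close>,
  the other is the identity outright.\<close>

lemma trivial_relative_homology_deformation_retract:
  fixes X A :: "'a::topological_space set"
  assumes "A \<subseteq> X"
    and cont: "continuous_on ({0..1::real} \<times> X) (\<lambda>(s,x). H s x)"
    and maps: "\<And>s x. \<lbrakk>s \<in> {0..1}; x \<in> X\<rbrakk> \<Longrightarrow> H s x \<in> X"
    and H0: "\<And>x. x \<in> X \<Longrightarrow> H 0 x = x"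
    and H1: "\<And>x. x \<in> X \<Longrightarrow> H 1 x \<in> A"
    and fix_A: "\<And>x. x \<in> A \<Longrightarrow> H 1 x = x"
  shows "trivial_group (relative_homology_group p (top_of_set X) A)"
proof (rule trivial_relative_homology_group_gen)
  have hom: "homotopic_with_canon (\<lambda>h. True) X X id (H 1)"
    unfolding homotopic_with[where P = "\<lambda>h. True", OF refl]
  proof (intro exI conjI ballI)
    show "continuous_map (prod_topology (top_of_set {0..1}) (top_of_set X)) (top_of_set X)
            (\<lambda>(s,x). H s x)"
      using cont maps by (force simp: prod_topology_subtopology_eu)
  qed (use H0 in auto)
  show "homotopic_with_canon (\<lambda>k. True) X X (H 1) id"
    using hom by (simp add: homotopic_with_symD)
  have "continuous_on X (H 1)"
    using homotopic_with_imp_continuous[OF hom] by simp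
  then show "continuous_map (top_of_set X) (subtopology (top_of_set X) A) (H 1)"
    using \<open>A \<subseteq> X\<close> H1 by (auto simp: subtopology_subtopology Int_absorb1 Int_absorb2)
  show "homotopic_with (\<lambda>h. True) (subtopology (top_of_set X) A) (subtopology (top_of_set X) A) (H 1) id"
    using \<open>A \<subseteq> X\<close> fix_A
    by (intro homotopic_with_equal) (auto simp: subtopology_subtopology Int_absorb1 Int_absorb2
          intro: continuous_map_eq[OF continuous_map_id])
qed

text \<open>In the exact sequence H_{p+1}(C,B) -> H_p(B,A) -> H_p(C,A) -> H_p(C,B) of the triple
  both outer groups vanish.\<close>

lemma relative_homology_iso_enlarge_space:
  assumes "A \<subseteq> B" "B \<subseteq> C"
    and triv: "\<And>p. trivial_group (relative_homology_group p (top_of_set C) B)"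
  shows "relative_homology_group p (top_of_set B) A \<cong> relative_homology_group p (top_of_set C) A"
proof -
  have eq: "subtopology (top_of_set C) B = top_of_set B"
    using assms by (simp add: subtopology_subtopology Int_absorb1 Int_absorb2)
  have "exact_seq ([relative_homology_group p (top_of_set C) B,
                    relative_homology_group p (top_of_set C) A,
                    relative_homology_group p (top_of_set B) A,
                    relative_homology_group (p + 1) (top_of_set C) B],
                   [hom_induced p (top_of_set C) A (top_of_set C) B id,
                    hom_induced p (top_of_set B) A (top_of_set C) A id,
                    hom_relboundary (p + 1) (top_of_set C) B A])"
    using homology_exactness_triple_3[OF \<open>A \<subseteq> B\<close>, of p "top_of_set C"]
      homology_exactness_triple_2[OF \<open>A \<subseteq> B\<close>, of "p + 1" "top_of_set C"]
    unfolding eq by (metis add_diff_cancel_right' exact_seq_cons_iff)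
  then show ?thesis
    using very_short_exact_sequence triv is_isoI by blast
qed

text \<open>The same triple, read one place further: H_p(B,A) and H_{p-1}(B,A) vanish on either side
  of H_p(C,A) -> H_p(C,B).\<close>

lemma relative_homology_iso_enlarge_subspace:
  assumes "A \<subseteq> B" "B \<subseteq> C"
    and triv: "\<And>p. trivial_group (relative_homology_group p (top_of_set B) A)"
  shows "relative_homology_group p (top_of_set C) A \<cong> relative_homology_group p (top_of_set C) B"
proof -
  have eq: "subtopology (top_of_set C) B = top_of_set B"
    using assms by (simp add: subtopology_subtopology Int_absorb1 Int_absorb2)
  have "exact_seq ([relative_homology_group (p - 1) (top_of_set B) A,
                    relative_homology_group p (top_of_set C) B,
                    relative_homology_group p (top_of_set C) A,
                    relative_homology_group p (top_of_set B) A],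
                   [hom_relboundary p (top_of_set C) B A,
                    hom_induced p (top_of_set C) A (top_of_set C) B id,
                    hom_induced p (top_of_set B) A (top_of_set C) A id])"
    using homology_exactness_triple_3[OF \<open>A \<subseteq> B\<close>, of p "top_of_set C"]
      homology_exactness_triple_1[OF \<open>A \<subseteq> B\<close>, of p "top_of_set C"]
    unfolding eq by (metis exact_seq_cons_iff)
  then show ?thesis
    using very_short_exact_sequence triv is_isoI by blast
qed

text \<open>Excise \<open>S \<inter> U - U'\<close>: its closure misses \<open>interior U'\<close>
  and hence \<open>x\<close>, while the complement of \<open>x\<close> is relatively open because
  points are closed.\<close>

lemma local_homology_excision:
  fixes S :: "'a::t1_space set"
  assumes "x \<in> interior U" "U' \<subseteq> U" "x \<in> interior U'"
  shows "relative_homology_group p (top_of_set (S \<inter> U')) (S \<inter> U' - {x}) \<cong>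
         relative_homology_group p (top_of_set (S \<inter> U)) (S \<inter> U - {x})"
proof -
  let ?X = "top_of_set (S \<inter> U)" and ?Z = "S \<inter> U - U'"
  have "?X closure_of ?Z \<subseteq> (S \<inter> U) - interior U'"
  proof (rule closure_of_minimal)
    show "?Z \<subseteq> S \<inter> U - interior U'"
      using interior_subset by auto
    show "closedin ?X (S \<inter> U - interior U')"
      by (auto simp: closedin_closed intro!: exI[of _ "- interior U'"])
  qed
  also have "\<dots> \<subseteq> S \<inter> U - {x}"
    using assms by auto
  also have "\<dots> \<subseteq> ?X interior_of (S \<inter> U - {x})"
    by (rule interior_of_maximal) (auto simp: openin_open intro!: exI[of _ "- {x}"])
  finally have "?X closure_of ?Z \<subseteq> ?X interior_of (S \<inter> U - {x})" .
  from homology_excision_axiom[OF this Diff_subset, of p]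
  have "relative_homology_group p (subtopology ?X (S \<inter> U - ?Z)) (S \<inter> U - {x} - ?Z) \<cong>
        relative_homology_group p (subtopology ?X (S \<inter> U)) (S \<inter> U - {x})"
    by (rule is_isoI)
  moreover have "subtopology ?X (S \<inter> U - ?Z) = top_of_set (S \<inter> U')"
      "subtopology ?X (S \<inter> U) = ?X" "S \<inter> U - {x} - ?Z = S \<inter> U' - {x}"
    using assms by (auto simp: subtopology_subtopology intro!: arg_cong[where f = top_of_set])
  ultimately show ?thesis
    by simp
qed

section \<open>Infinite descent homotopies\<close>

primrec iterate :: "(real \<Rightarrow> 'a \<Rightarrow> 'a) \<Rightarrow> (nat \<Rightarrow> real) \<Rightarrow> nat \<Rightarrow> 'a \<Rightarrow> 'a" where
  "iterate h t 0 x = x"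
| "iterate h t (Suc n) x = h (t n) (iterate h t n x)"

text \<open>\<open>ramp n\<close> rises from 0 to 1 on the interval from \<open>n / (n + 1)\<close> to \<open>(n + 1) / (n + 2)\<close>, so that the
  \<open>n\<close>-th step of an infinite composition is performed during that time.\<close>

definition ramp :: "nat \<Rightarrow> real \<Rightarrow> real" where
  "ramp n s = max 0 (min 1 ((real n + 1) * (real n + 2) * s - real n * (real n + 2)))"

lemma ramp_bounds: "ramp n s \<in> {0..1}"
  by (auto simp: ramp_def)

lemma ramp_1 [simp]: "ramp n 1 = 1"
proof -
  have "(real n + 1) * (real n + 2) * 1 - real n * (real n + 2) \<ge> 1"
    by (simp add: algebra_simps)
  then show ?thesis by (simp add: ramp_def)
qed

lemma ramp_eq_0:
  assumes "s * (real n + 1) \<le> real n"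
  shows "ramp n s = 0"
proof -
  have "(real n + 1) * (real n + 2) * s - real n * (real n + 2) = (s * (real n + 1) - real n) * (real n + 2)"
    by (simp add: algebra_simps)
  also have "\<dots> \<le> 0"
    using assms by (simp add: mult_nonpos_nonneg)
  finally show ?thesis unfolding ramp_def by linarith
qed

lemma ramp_0 [simp]: "ramp n 0 = 0"
  by (simp add: ramp_eq_0)

text \<open>Step \<open>k\<close> is complete at time (k+1)/(k+2), which is at most m/(m+1), the
  time at which step \<open>m\<close> starts; so the steps run one after another.\<close>

lemma ramp_successive:
  assumes "ramp k s < 1" "k < m"
  shows "ramp m s = 0"
proof (rule ramp_eq_0)
  have "(real k + 1) * (real k + 2) * s - real k * (real k + 2) < 1"
    using assms by (auto simp: ramp_def)
  then have "(real k + 1) * ((real k + 2) * s) < (real k + 1) * (real k + 1)"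
    by (simp add: algebra_simps)
  then have "(real k + 2) * s < real k + 1"
    by (metis mult_less_cancel_left_pos of_nat_0_le_iff add_nonneg_pos zero_less_one)
  then have 1: "1 < (1 - s) * (real k + 2)"
    by (simp add: algebra_simps)
  have "0 \<le> 1 - s"
    by (rule ccontr) (use 1 in \<open>simp add: not_le mult_less_0_iff; smt (verit) mult_neg_pos of_nat_0_le_iff\<close>)
  then have "(1 - s) * (real k + 2) \<le> (1 - s) * (real m + 1)"
    using assms by (intro mult_left_mono) auto
  then show "s * (real m + 1) \<le> real m"
    using 1 by (simp add: algebra_simps)
qed

text \<open>Lets estimates at an arbitrary time be split: the first \<open>n\<close> steps are full
  ones, or nothing moves from step \<open>n\<close> on.\<close>

lemma ramp_dichotomy: "(\<forall>k<n. ramp k s = 1) \<or> (\<forall>m\<ge>n. ramp m s = 0)"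
  using ramp_successive[of _ s] ramp_bounds[of _ s]
  by (meson atLeastAtMost_iff less_le_trans linorder_less_linear not_less)

lemma continuous_on_ramp: "continuous_on S (ramp n)"
  unfolding ramp_def by (intro continuous_intros)

text \<open>\<open>W - X\<close> may contain a critical point, which the orbits of points of \<open>X\<close> cannot accumulate at
  because \<open>\<phi>\<close> drops below its value already in the first step.\<close>

locale descent =
  fixes W X :: "'a::metric_space set" and h :: "real \<Rightarrow> 'a \<Rightarrow> 'a" and \<phi> :: "'a \<Rightarrow> real" and a :: real
  assumes compact_W: "compact W"
    and X_subset: "X \<subseteq> W"
    and cont_\<phi>: "continuous_on W \<phi>"
    and cont_h: "continuous_on ({0..1} \<times> W) (\<lambda>(s,x). h s x)"
    and h_W: "\<And>s x. \<lbrakk>s \<in> {0..1}; x \<in> W\<rbrakk> \<Longrightarrow> h s x \<in> W"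
    and h_X: "\<And>s x. \<lbrakk>s \<in> {0..1}; x \<in> X\<rbrakk> \<Longrightarrow> h s x \<in> X"
    and h_0: "\<And>x. x \<in> X \<Longrightarrow> h 0 x = x"
    and h_fix: "\<And>s x. \<lbrakk>s \<in> {0..1}; x \<in> X; \<phi> x \<le> a\<rbrakk> \<Longrightarrow> h s x = x"
    and \<phi>_h_le: "\<And>s x. \<lbrakk>s \<in> {0..1}; x \<in> X\<rbrakk> \<Longrightarrow> \<phi> (h s x) \<le> \<phi> x"
    and \<phi>_h_less: "\<And>x. \<lbrakk>x \<in> X; a < \<phi> x\<rbrakk> \<Longrightarrow> \<phi> (h 1 x) < \<phi> x"
    and removed: "\<And>x y. \<lbrakk>x \<in> X; y \<in> W - X\<rbrakk> \<Longrightarrow> \<phi> (h 1 x) < \<phi> y \<and> a < \<phi> y"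
    and chain_small: "\<And>e. e > 0 \<Longrightarrow> \<exists>d>0. \<forall>y m. (\<forall>k. y k \<in> X \<and> (\<exists>s\<in>{0..1}. y (Suc k) = h s (y k)))
                          \<longrightarrow> \<phi> (y 0) < a + d \<longrightarrow> dist (y m) (y 0) < e"
begin

section \<open>Convergence of orbits and the limiting homotopy\<close>

lemma iterate_X: "\<lbrakk>\<And>k. t k \<in> {0..1}; x \<in> X\<rbrakk> \<Longrightarrow> iterate h t n x \<in> X"
  by (induction n) (simp_all add: h_X)

lemma iterate_fix: "\<lbrakk>\<And>k. t k \<in> {0..1}; x \<in> X; \<phi> x \<le> a\<rbrakk> \<Longrightarrow> iterate h t n x = x"
  by (induction n) (simp_all add: h_fix)

lemma \<phi>_iterate_antimono:
  assumes "\<And>k. t k \<in> {0..1}" "x \<in> X"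
  shows "antimono (\<lambda>n. \<phi> (iterate h t n x))"
  by (rule decseq_SucI) (use assms in \<open>simp add: \<phi>_h_le[OF assms(1) iterate_X]\<close>)

lemma continuous_on_iterate:
  assumes "\<And>n. continuous_on {0..1} (\<lambda>s. t s n)" "\<And>s k. t s k \<in> {0..1}"
  shows "continuous_on ({0..1} \<times> X) (\<lambda>(s,x). iterate h (t s) n x)"
proof (induction n)
  case 0
  then show ?case by (simp add: case_prod_unfold continuous_on_snd)
next
  case (Suc n)
  have "continuous_on ({0..1} \<times> X) (\<lambda>p. t (fst p) n)"
    by (rule continuous_on_compose2[OF assms(1)]) (auto intro: continuous_on_fst)
  with Suc have "continuous_on ({0..1} \<times> X) (\<lambda>p. (t (fst p) n, iterate h (t (fst p)) n (snd p)))"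
    by (intro continuous_intros) (auto simp: case_prod_unfold)
  then have "continuous_on ({0..1} \<times> X) (\<lambda>p. (\<lambda>(s,x). h s x) (t (fst p) n, iterate h (t (fst p)) n (snd p)))"
    by (rule continuous_on_compose2[OF cont_h]) (use assms iterate_X X_subset in fastforce)
  then show ?case by (simp add: case_prod_unfold)
qed

lemma continuous_on_iterate_ramp:
  "continuous_on ({0..1} \<times> X) (\<lambda>(s,x). iterate h (\<lambda>k. ramp k s) n x)"
  by (rule continuous_on_iterate) (use ramp_bounds continuous_on_ramp in auto)

text \<open>A LaSalle argument: otherwise the decreasing values tend to some \<open>L > a\<close>,
  and an accumulation point \<open>y\<close> of the orbit satisfies
  \<open>\<phi> (h 1 y) = \<phi> y = L\<close>, contradicting strict decrease.\<close>

lemma \<phi>_iterate_eventually_below: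
  assumes x: "x \<in> X" and d: "d > 0"
  shows "\<exists>n. \<phi> (iterate h (\<lambda>_. 1) n x) < a + d"
proof (rule ccontr)
  define z where "z n = iterate h (\<lambda>_. 1) n x" for n
  assume "\<not> ?thesis"
  then have ge: "a + d \<le> \<phi> (z n)" for n
    by (auto simp: z_def not_less)
  have zX: "z n \<in> X" for n
    unfolding z_def by (rule iterate_X) (use x in auto)
  have anti: "antimono (\<lambda>n. \<phi> (z n))"
    unfolding z_def by (rule \<phi>_iterate_antimono) (use x in auto)
  obtain L where L: "(\<lambda>n. \<phi> (z n)) \<longlonglongrightarrow> L" "\<And>n. L \<le> \<phi> (z n)"
    using decseq_convergent[OF anti, of "a + d"] ge by blast
  obtain y r where y: "y \<in> W" and r: "strict_mono (r :: nat \<Rightarrow> nat)" and lim: "(z \<circ> r) \<longlonglongrightarrow> y"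
    using compact_W zX X_subset by (meson compact_imp_seq_compact seq_compactE subsetD)
  have zW: "z n \<in> W" for n using zX X_subset by auto
  have "(\<lambda>n. \<phi> ((z \<circ> r) n)) \<longlonglongrightarrow> \<phi> y"
    by (rule continuous_on_tendsto_compose[OF cont_\<phi> lim y]) (use zW in auto)
  moreover have "(\<lambda>n. \<phi> ((z \<circ> r) n)) \<longlonglongrightarrow> L"
    using LIMSEQ_subseq_LIMSEQ[OF L(1) r] by (simp add: o_def)
  ultimately have \<phi>y: "\<phi> y = L"
    using LIMSEQ_unique by blast
  have cont_h1: "continuous_on W (h 1)"
    using continuous_on_compose2[OF cont_h, of W "\<lambda>x. (1, x)"] by (force intro: continuous_intros)
  have "continuous_on W (\<lambda>x. \<phi> (h 1 x))"
    by (rule continuous_on_compose2[OF cont_\<phi> cont_h1]) (use h_W in auto)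
  then have "(\<lambda>n. \<phi> (h 1 ((z \<circ> r) n))) \<longlonglongrightarrow> \<phi> (h 1 y)"
    by (rule continuous_on_tendsto_compose[OF _ lim y]) (use zW in auto)
  moreover have "(\<lambda>n. \<phi> (h 1 ((z \<circ> r) n))) \<longlonglongrightarrow> L"
    using LIMSEQ_subseq_LIMSEQ[OF LIMSEQ_Suc[OF L(1)] r] by (simp add: o_def z_def)
  ultimately have "\<phi> (h 1 y) = L"
    using LIMSEQ_unique by blast
  moreover have "a < L"
    using LIMSEQ_le_const[OF L(1)] ge d by (meson less_add_same_cancel1 less_le_trans)
  \<comment> \<open>A limit point outside \<open>X\<close> would have a value above
    \<open>\<phi> (z 1)\<close>, whereas \<open>L\<close> lies below every
    \<open>\<phi> (z n)\<close>.\<close>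
  moreover have "y \<in> X"
  proof (rule ccontr)
    assume "y \<notin> X"
    then have "\<phi> (h 1 (z 0)) < \<phi> y"
      using removed[OF zX[of 0], of y] y by auto
    moreover have "h 1 (z 0) = z 1"
      by (simp add: z_def)
    ultimately show False
      using L(2)[of 1] \<phi>y by simp
  qed
  ultimately show False
    using \<phi>_h_less \<phi>y by fastforce
qed

text \<open>The smallness condition concerns only full steps, so the tail estimate is uniform in the
  time \<open>s\<close>. By \<open>ramp_dichotomy\<close>, the orbit from index \<open>n\<close> on
  either starts at the full-step iterate, where \<open>chain_small\<close> applies, or is
  constant.\<close>

lemma iterate_ramp_Cauchy:
  assumes e: "e > 0"
  obtains d where "d > 0"
    "\<And>s x n m. \<lbrakk>x \<in> X; \<phi> (iterate h (\<lambda>_. 1) n x) < a + d; n \<le> m\<rbrakk> \<Longrightarrow>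
       dist (iterate h (\<lambda>k. ramp k s) m x) (iterate h (\<lambda>k. ramp k s) n x) < e"
proof -
  obtain d where "d > 0" and
    d: "\<And>y m. \<lbrakk>\<And>k. y k \<in> X \<and> (\<exists>s\<in>{0..1}. y (Suc k) = h s (y k)); \<phi> (y 0) < a + d\<rbrakk> \<Longrightarrow> dist (y m) (y 0) < e"
    using chain_small[OF e] by metis
  have "dist (iterate h (\<lambda>k. ramp k s) m x) (iterate h (\<lambda>k. ramp k s) n x) < e"
    if x: "x \<in> X" and less: "\<phi> (iterate h (\<lambda>_. 1) n x) < a + d" and "n \<le> m" for s x n m
  proof -
    define y where "y k = iterate h (\<lambda>k. ramp k s) (n + k) x" for k
    have yX: "y k \<in> X" for k
      unfolding y_def by (rule iterate_X) (use ramp_bounds x in auto)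
    have y_Suc: "y (Suc k) = h (ramp (n + k) s) (y k)" for k
      by (simp add: y_def)
    consider "\<forall>k<n. ramp k s = 1" | "\<forall>m\<ge>n. ramp m s = 0"
      using ramp_dichotomy by blast
    then have "dist (y (m - n)) (y 0) < e"
    proof cases
      case 1
      have "iterate h (\<lambda>k. ramp k s) j x = iterate h (\<lambda>_. 1) j x" if "j \<le> n" for j
        using that by (induction j) (auto simp: 1)
      then have "\<phi> (y 0) < a + d"
        using less by (simp add: y_def)
      then show ?thesis
        using yX y_Suc ramp_bounds by (intro d) blast+
    next
      case 2
      have "y k = y 0" for k
        by (induction k) (use 2 in \<open>auto simp: y_Suc h_0 yX\<close>)
      then show ?thesis using e by (metis dist_self)
    qed
    then show ?thesis
      using \<open>n \<le> m\<close> by (simp add: y_def)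
  qed
  with \<open>d > 0\<close> show thesis
    using that by blast
qed

text \<open>On \<open>X\<close> and for \<open>s < 1\<close> only finitely many steps are active,
  the others being \<open>h 0\<close>; a genuine limit occurs only at the end of the time
  interval.\<close>

definition flow :: "real \<Rightarrow> 'a \<Rightarrow> 'a" where
  "flow s x = lim (\<lambda>n. iterate h (\<lambda>k. ramp k s) n x)"

lemma iterate_ramp_tendsto:
  assumes x: "x \<in> X"
  shows "(\<lambda>n. iterate h (\<lambda>k. ramp k s) n x) \<longlonglongrightarrow> flow s x" and "flow s x \<in> W"
proof -
  let ?y = "\<lambda>n. iterate h (\<lambda>k. ramp k s) n x"
  have yW: "?y n \<in> W" for n
    using iterate_X[of "\<lambda>k. ramp k s" x n] ramp_bounds x X_subset by blast
  have "Cauchy ?y"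
  proof (rule metric_CauchyI)
    fix e :: real assume "e > 0"
    then obtain d where "d > 0" and d:
      "\<And>s x n m. \<lbrakk>x \<in> X; \<phi> (iterate h (\<lambda>_. 1) n x) < a + d; n \<le> m\<rbrakk> \<Longrightarrow>
       dist (iterate h (\<lambda>k. ramp k s) m x) (iterate h (\<lambda>k. ramp k s) n x) < e/2"
      using iterate_ramp_Cauchy[of "e/2"] by (metis half_gt_zero)
    obtain n where n: "\<phi> (iterate h (\<lambda>_. 1) n x) < a + d"
      using \<phi>_iterate_eventually_below x \<open>d > 0\<close> by blast
    then show "\<exists>M. \<forall>m\<ge>M. \<forall>n\<ge>M. dist (?y m) (?y n) < e"
      using d[OF x n, of _ s] by (metis dist_triangle_half_l)
  qed
  then obtain l where "l \<in> W" "?y \<longlonglongrightarrow> l"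
    using compact_imp_complete[OF compact_W] yW unfolding complete_def by metis
  then show "?y \<longlonglongrightarrow> flow s x" "flow s x \<in> W"
    by (simp_all add: flow_def limI)
qed

lemma \<phi>_flow_1_le:
  assumes x: "x \<in> X"
  shows "\<phi> (flow 1 x) \<le> a"
proof (rule field_le_epsilon)
  fix d :: real assume "d > 0"
  then obtain n where n: "\<phi> (iterate h (\<lambda>_. 1) n x) < a + d"
    using \<phi>_iterate_eventually_below x by blast
  have *: "\<phi> (iterate h (\<lambda>k. ramp k 1) m x) \<le> a + d" if "m \<ge> n" for m
    using antimonoD[OF \<phi>_iterate_antimono[of "\<lambda>_. 1" x] that] x n by simp
  have "(\<lambda>n. \<phi> (iterate h (\<lambda>k. ramp k 1) n x)) \<longlonglongrightarrow> \<phi> (flow 1 x)"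
    using iterate_X[of "\<lambda>_. 1" x] x X_subset
    by (intro continuous_on_tendsto_compose[OF cont_\<phi> iterate_ramp_tendsto[OF x]])
      (auto intro: always_eventually)
  then show "\<phi> (flow 1 x) \<le> a + d"
    using * by (meson LIMSEQ_le_const2)
qed

text \<open>If the orbit becomes stationary, its limit is one of its members. Otherwise all steps
  are full, so the limit lies at or below level \<open>a\<close>, while the points of
  \<open>W - X\<close> lie above it.\<close>

lemma flow_X:
  assumes x: "x \<in> X"
  shows "flow s x \<in> X"
proof (cases "\<exists>n. \<forall>m\<ge>n. ramp m s = 0")
  case True
  then obtain n where n: "\<And>m. m \<ge> n \<Longrightarrow> ramp m s = 0"
    by blast
  have X: "iterate h (\<lambda>k. ramp k s) m x \<in> X" for m
    by (rule iterate_X) (use ramp_bounds x in auto)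
  have "iterate h (\<lambda>k. ramp k s) m x = iterate h (\<lambda>k. ramp k s) n x" if "m \<ge> n" for m
    using that by (induction m rule: dec_induct) (auto simp: n h_0 X)
  then have "(\<lambda>m. iterate h (\<lambda>k. ramp k s) m x) \<longlonglongrightarrow> iterate h (\<lambda>k. ramp k s) n x"
    by (intro tendsto_eventually eventually_sequentiallyI)
  then have "flow s x = iterate h (\<lambda>k. ramp k s) n x"
    by (rule LIMSEQ_unique[OF iterate_ramp_tendsto(1)[OF x]])
  then show ?thesis
    using X by simp
next
  case False
  then have "ramp k s = 1" for k
    using ramp_dichotomy[of "Suc k" s] by (meson lessI)
  then have "flow s x = flow 1 x"
    by (simp add: flow_def)
  then show ?thesis
    using \<phi>_flow_1_le[OF x] iterate_ramp_tendsto(2)[OF x, of 1] removed[OF x, of "flow 1 x"] by auto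
qed

text \<open>A fixed finite iterate is continuous, and its distance to the limit is uniformly small
  near \<open>p\<close>, since the condition in \<open>iterate_ramp_Cauchy\<close> is open in
  \<open>x\<close> and independent of \<open>s\<close>.\<close>

lemma continuous_on_flow: "continuous_on ({0..1} \<times> X) (\<lambda>(s,x). flow s x)"
  unfolding continuous_on_eq_continuous_within continuous_within
proof (intro ballI tendstoI)
  fix p :: "real \<times> 'a" and e :: real assume p: "p \<in> {0..1} \<times> X" and "e > 0"
  let ?S = "{0..1::real} \<times> X"
  obtain d where "d > 0" and d:
    "\<And>s x n m. \<lbrakk>x \<in> X; \<phi> (iterate h (\<lambda>_. 1) n x) < a + d; n \<le> m\<rbrakk> \<Longrightarrow>
     dist (iterate h (\<lambda>k. ramp k s) m x) (iterate h (\<lambda>k. ramp k s) n x) < e/4"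
    using iterate_ramp_Cauchy[of "e/4"] \<open>e > 0\<close> by (metis zero_less_divide_iff zero_less_numeral)
  obtain n where n: "\<phi> (iterate h (\<lambda>_. 1) n (snd p)) < a + d"
    using \<phi>_iterate_eventually_below p \<open>d > 0\<close> by (metis mem_Times_iff)
  have close: "dist (iterate h (\<lambda>k. ramp k s) n x) (flow s x) \<le> e/4"
    if "x \<in> X" "\<phi> (iterate h (\<lambda>_. 1) n x) < a + d" for s x
  proof (rule Lim_dist_ubound[OF _ iterate_ramp_tendsto(1)[OF that(1)]])
    show "\<forall>\<^sub>F m in sequentially. dist (iterate h (\<lambda>k. ramp k s) n x) (iterate h (\<lambda>k. ramp k s) m x) \<le> e/4"
      using d[OF that, of _ s]
      by (auto simp: eventually_sequentially dist_commute intro!: exI[of _ n] less_imp_le)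
  qed simp
  have "continuous_on ?S (\<lambda>(s,x). iterate h (\<lambda>_. 1) n x)"
    by (rule continuous_on_iterate) auto
  then have "continuous_on ?S (\<lambda>q. \<phi> ((\<lambda>(s,x). iterate h (\<lambda>_. 1) n x) q))"
    by (rule continuous_on_compose2[OF cont_\<phi>]) (use iterate_X[of "\<lambda>_. 1"] X_subset in fastforce)
  then have "\<forall>\<^sub>F q in at p within ?S. \<phi> (iterate h (\<lambda>_. 1) n (snd q)) < a + d"
    using p by (intro order_tendstoD(2)[OF _ n]) (auto simp: continuous_on_def case_prod_unfold)
  moreover have "\<forall>\<^sub>F q in at p within ?S. dist (iterate h (\<lambda>k. ramp k (fst q)) n (snd q))
                     (iterate h (\<lambda>k. ramp k (fst p)) n (snd p)) < e/4"
    using continuous_on_iterate_ramp[of n] p \<open>e > 0\<close>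
    by (intro tendstoD) (auto simp: continuous_on_def case_prod_unfold)
  moreover have "\<forall>\<^sub>F q in at p within ?S. q \<in> ?S"
    by (simp add: eventually_at_filter)
  ultimately show "\<forall>\<^sub>F q in at p within ?S. dist (case q of (s,x) \<Rightarrow> flow s x) (case p of (s,x) \<Rightarrow> flow s x) < e"
  proof eventually_elim
    case (elim q)
    have "dist (iterate h (\<lambda>k. ramp k (fst q)) n (snd q)) (flow (fst q) (snd q)) \<le> e/4"
         "dist (iterate h (\<lambda>k. ramp k (fst p)) n (snd p)) (flow (fst p) (snd p)) \<le> e/4"
      using elim p n by (intro close; simp add: mem_Times_iff)+
    then have "dist (flow (fst q) (snd q)) (flow (fst p) (snd p)) < e"
      using elim(2) \<open>e > 0\<close> by metric
    then show ?case by (simp add: case_prod_unfold)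
  qed
qed

lemma trivial_relative_homology:
  "trivial_group (relative_homology_group p (top_of_set X) {x \<in> X. \<phi> x \<le> a})"
proof (rule trivial_relative_homology_deformation_retract[where H = flow])
  show "flow 0 x = x" if "x \<in> X" for x
  proof -
    have "iterate h (\<lambda>k. ramp k 0) n x = x" for n
      by (induction n) (simp_all add: h_0 that)
    then show ?thesis by (simp add: flow_def)
  qed
  show "flow 1 x = x" if "x \<in> {x \<in> X. \<phi> x \<le> a}" for x
    using that by (simp add: flow_def iterate_fix)
qed (use continuous_on_flow flow_X \<phi>_flow_1_le in auto)

end

section \<open>Euler steps\<close>

text \<open>Here \<phi> is to be decreased to level \<open>a\<close> inside the constraints
  \<open>g \<le> \<mu>\<close> and \<open>f \<le> b\<close>, along whose boundaries
  \<open>- D\<phi>\<close> points inwards. \<open>X\<close> is the constrained set, possibly with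
  the critical point 0 removed: if 0 is kept it already lies in the target, and if it is removed it
  lies at least as high as all of \<open>X\<close>.\<close>

locale euler_descent =
  fixes K X :: "'a::euclidean_space set"
    and \<phi> f g :: "'a \<Rightarrow> real" and D\<phi> Df Dg :: "'a \<Rightarrow> 'a" and a b \<mu> :: real
  assumes compact_K: "compact K"
    and cont: "continuous_on K \<phi>" "continuous_on K f" "continuous_on K g"
    and cont_D: "continuous_on K D\<phi>" "continuous_on K Df" "continuous_on K Dg"
    and deriv: "\<And>x. x \<in> interior K \<Longrightarrow> GDERIV \<phi> x :> D\<phi> x"
      "\<And>x. x \<in> interior K \<Longrightarrow> GDERIV f x :> Df x"
      "\<And>x. x \<in> interior K \<Longrightarrow> GDERIV g x :> Dg x"
    and zero: "0 \<in> K" "D\<phi> 0 = 0" "\<And>x. \<lbrakk>x \<in> K; D\<phi> x = 0\<rbrakk> \<Longrightarrow> x = 0"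
    and X_sub: "X \<subseteq> {x \<in> K. g x \<le> \<mu> \<and> f x \<le> b}"
    and sub_X: "{x \<in> K. g x \<le> \<mu> \<and> f x \<le> b} - {0} \<subseteq> X"
    and zero_in: "0 \<in> X \<Longrightarrow> \<phi> 0 \<le> a"
    and zero_out: "\<lbrakk>g 0 \<le> \<mu>; f 0 \<le> b; 0 \<notin> X\<rbrakk> \<Longrightarrow> a < \<phi> 0"
      "\<And>x. \<lbrakk>g 0 \<le> \<mu>; f 0 \<le> b; 0 \<notin> X; x \<in> X\<rbrakk> \<Longrightarrow> \<phi> x \<le> \<phi> 0"
    and admissible: "\<And>x. \<lbrakk>x \<in> X; a < \<phi> x\<rbrakk> \<Longrightarrow> x \<in> interior K"
      "\<And>x. \<lbrakk>x \<in> X; a < \<phi> x; f x = b\<rbrakk> \<Longrightarrow> D\<phi> x \<bullet> Df x > 0"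
      "\<And>x. \<lbrakk>x \<in> X; a < \<phi> x; g x = \<mu>\<rbrakk> \<Longrightarrow> D\<phi> x \<bullet> Dg x > 0"
begin

definition W :: "'a set" where "W = {x \<in> K. g x \<le> \<mu> \<and> f x \<le> b}"

text \<open>A step from \<open>x\<close> to \<open>y\<close> in direction \<open>- D\<phi> x\<close> is unsafe if it leaves the interior of \<open>K\<close>,
  crosses the target level, loses the descent rate of \<open>\<phi>\<close>, or violates a constraint that does not
  decrease along the step. Safe step lengths are read off the distance of \<open>(x, x)\<close> to this closed
  set, which is continuous in \<open>x\<close>.\<close>

definition unsafe :: "('a \<times> 'a) set" where
  "unsafe = K \<times> (- interior K) \<union>
     {p \<in> K \<times> K. \<phi> (snd p) \<le> a} \<union>
     {p \<in> K \<times> K. D\<phi> (fst p) \<bullet> D\<phi> (snd p) \<le> (D\<phi> (fst p) \<bullet> D\<phi> (fst p)) / 2} \<union>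
     ({p \<in> K \<times> K. b \<le> f (snd p)} \<inter> {p \<in> K \<times> K. D\<phi> (fst p) \<bullet> Df (snd p) \<le> 0}) \<union>
     ({p \<in> K \<times> K. \<mu> \<le> g (snd p)} \<inter> {p \<in> K \<times> K. D\<phi> (fst p) \<bullet> Dg (snd p) \<le> 0})"

text \<open>The denominator keeps the displacement below half the distance to \<open>unsafe\<close>;
  the cap 1 makes steps short wherever \<open>D\<phi>\<close> is small.\<close>

definition step_size :: "'a \<Rightarrow> real" where
  "step_size x = min 1 (infdist (x, x) unsafe / (2 * (1 + norm (D\<phi> x))))"

definition euler :: "real \<Rightarrow> 'a \<Rightarrow> 'a" where
  "euler s x = x - (s * step_size x) *\<^sub>R D\<phi> x"

section \<open>Safety and positivity of the step length\<close>

lemma closed_unsafe: "closed unsafe"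
proof -
  have fst: "continuous_on (K \<times> K) (\<lambda>p. F (fst p))" and snd: "continuous_on (K \<times> K) (\<lambda>p. F (snd p))"
    if "continuous_on K F" for F :: "'a \<Rightarrow> 'b::topological_space"
    by (rule continuous_on_compose2[OF that]; force intro: continuous_intros)+
  have KK: "closed (K \<times> K)"
    using compact_K by (intro closed_Times compact_imp_closed)
  have le: "closed {p \<in> K \<times> K. F p \<le> G p}"
    if "continuous_on (K \<times> K) F" "continuous_on (K \<times> K) G" for F G :: "'a \<times> 'a \<Rightarrow> real"
    using continuous_on_closed_Collect_le[OF that KK] .
  have "closed (K \<times> (- interior K))"
    using compact_K by (intro closed_Times) (auto simp: compact_imp_closed)
  moreover have "closed {p \<in> K \<times> K. \<phi> (snd p) \<le> a}"
    by (intro le snd cont continuous_on_const)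
  moreover have "closed {p \<in> K \<times> K. D\<phi> (fst p) \<bullet> D\<phi> (snd p) \<le> (D\<phi> (fst p) \<bullet> D\<phi> (fst p)) / 2}"
    by (intro le continuous_on_inner continuous_on_divide fst snd cont_D continuous_on_const) auto
  moreover have "closed {p \<in> K \<times> K. b \<le> f (snd p)}" "closed {p \<in> K \<times> K. \<mu> \<le> g (snd p)}"
    by (intro le snd cont continuous_on_const)+
  moreover have "closed {p \<in> K \<times> K. D\<phi> (fst p) \<bullet> Df (snd p) \<le> 0}"
    "closed {p \<in> K \<times> K. D\<phi> (fst p) \<bullet> Dg (snd p) \<le> 0}"
    by (intro le continuous_on_inner fst snd cont_D continuous_on_const)+
  ultimately show ?thesis
    unfolding unsafe_def by (intro closed_Un closed_Int)
qed

text \<open>Ensures that \<open>unsafe\<close> is nonempty; \<open>infdist\<close> to the empty set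
  is 0 by convention and would not detect safety.\<close>

lemma origin_unsafe: "(0, 0) \<in> unsafe"
  using zero by (simp add: unsafe_def)

lemma step_size_pos_iff: "x \<in> K \<Longrightarrow> 0 < step_size x \<longleftrightarrow> (x, x) \<notin> unsafe"
proof -
  have "0 < step_size x \<longleftrightarrow> 0 < infdist (x, x) unsafe"
    by (auto simp: step_size_def zero_less_divide_iff intro!: add_pos_nonneg)
      (smt (verit) norm_ge_zero)+
  also have "\<dots> \<longleftrightarrow> (x, x) \<notin> unsafe"
    using in_closed_iff_infdist_zero[OF closed_unsafe, of "(x, x)"] origin_unsafe
      infdist_nonneg[of "(x, x)" unsafe] by (metis empty_iff order_less_le)
  finally show ?thesis .
qed

lemma step_size_nonneg: "0 \<le> step_size x"
  by (simp add: step_size_def infdist_nonneg)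

lemma continuous_on_step_size: "continuous_on K step_size"
proof -
  have "2 * (1 + norm (D\<phi> x)) \<noteq> 0" for x
    by (smt (verit) norm_ge_zero)
  then show ?thesis
    unfolding step_size_def by (intro continuous_intros cont_D) blast
qed

text \<open>Every point of the step moves \<open>(x, x)\<close> by at most half its distance to
  \<open>unsafe\<close>, and that distance is positive.\<close>

lemma euler_safe:
  assumes x: "x \<in> K" "0 < step_size x" and s: "s \<in> {0..1}"
  shows "(x, euler s x) \<notin> unsafe"
proof
  assume "(x, euler s x) \<in> unsafe"
  then have "infdist (x, x) unsafe \<le> dist (x, x) (x, euler s x)"
    by (rule infdist_le)
  also have "\<dots> = s * step_size x * norm (D\<phi> x)"
    using s step_size_nonneg by (simp add: dist_Pair_Pair euler_def dist_norm)
  also have "\<dots> \<le> step_size x * (1 + norm (D\<phi> x))"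
    using s x by (intro mult_mono) (auto simp: mult_left_le_one_le)
  also have "\<dots> \<le> infdist (x, x) unsafe / (2 * (1 + norm (D\<phi> x))) * (1 + norm (D\<phi> x))"
    by (intro mult_right_mono) (auto simp: step_size_def)
  also have "\<dots> = infdist (x, x) unsafe / 2"
  proof -
    have "1 + norm (D\<phi> x) \<noteq> 0"
      by (smt (verit) norm_ge_zero)
    then show ?thesis
      by (simp only: times_divide_eq_left nonzero_mult_divide_mult_cancel_right not_False_eq_True)
  qed
  finally have "infdist (x, x) unsafe \<le> 0" by simp
  then show False
    using x step_size_pos_iff[OF x(1)] closed_unsafe origin_unsafe infdist_pos_not_in_closed
    by (metis empty_iff not_le)
qed

lemma euler_no_step: "step_size x \<le> 0 \<Longrightarrow> euler s x = x"
  using step_size_nonneg[of x] by (simp add: euler_def)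

lemma step_size_level: "\<lbrakk>x \<in> K; \<phi> x \<le> a\<rbrakk> \<Longrightarrow> step_size x \<le> 0"
  using step_size_pos_iff[of x] by (force simp: unsafe_def)

lemma step_size_pos:
  assumes "x \<in> X" "a < \<phi> x"
  shows "0 < step_size x"
proof -
  have "x \<in> K" "x \<noteq> 0"
    using assms X_sub zero_in by auto
  then have "D\<phi> x \<bullet> D\<phi> x > 0"
    using zero by auto
  \<comment> \<open>Since \<open>X\<close> satisfies the constraints, \<open>b \<le> f x\<close>
    means \<open>f x = b\<close>, and likewise for \<open>g\<close>; then \<open>admissible\<close>
    excludes the last two pieces of \<open>unsafe\<close>.\<close>
  then show ?thesis
    using assms X_sub admissible[of x] unfolding step_size_pos_iff[OF \<open>x \<in> K\<close>]
    by (force simp: unsafe_def)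
qed

section \<open>Effect of a single Euler step\<close>

lemma euler_mvt:
  assumes x: "x \<in> K" "0 < step_size x" and "0 \<le> s" "s < t" "t \<le> 1"
    and F: "\<And>y. y \<in> interior K \<Longrightarrow> GDERIV F y :> DF y"
  obtains r where "s < r" "r < t"
    "F (euler t x) - F (euler s x) = - ((t - s) * step_size x * (D\<phi> x \<bullet> DF (euler r x)))"
proof -
  have deriv: "((\<lambda>r. F (euler r x)) has_derivative
      (\<lambda>v. v * (- (step_size x * (D\<phi> x \<bullet> DF (euler r x)))))) (at r)" if "r \<in> {s..t}" for r
  proof -
    have "euler r x \<in> interior K"
      using euler_safe[OF x, of r] that assms by (auto simp: unsafe_def)
    then have "(F has_derivative (\<lambda>v. v \<bullet> DF (euler r x))) (at (euler r x))"
      using F by (simp add: gderiv_def inner_commute)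
    moreover have "((\<lambda>r. euler r x) has_derivative (\<lambda>v. - (v * step_size x) *\<^sub>R D\<phi> x)) (at r)"
      unfolding euler_def by (auto intro!: derivative_eq_intros)
    ultimately have "((\<lambda>r. F (euler r x)) has_derivative
        (\<lambda>v. (- (v * step_size x) *\<^sub>R D\<phi> x) \<bullet> DF (euler r x))) (at r)"
      by (rule has_derivative_compose[rotated])
    then show ?thesis
      by (simp add: mult.assoc)
  qed
  obtain r where "r \<in> {s<..<t}"
    "F (euler t x) - F (euler s x) = (t - s) * (- (step_size x * (D\<phi> x \<bullet> DF (euler r x))))"
    using mvt_simple[OF \<open>s < t\<close> has_derivative_at_withinI[OF deriv]] by auto
  then show thesis
    by (intro that[of r]) auto
qed

text \<open>After the last time \<open>q\<close> at which the constraint holds, \<open>F\<close>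
  stays above \<beta>, where safety makes it decrease along the step; the mean value theorem between
  \<open>q\<close> and \<open>s\<close> then gives a contradiction.\<close>

lemma euler_constraint:
  assumes x: "x \<in> K" "0 < step_size x" "F x \<le> \<beta>" and s: "s \<in> {0..1}"
    and F: "\<And>y. y \<in> interior K \<Longrightarrow> GDERIV F y :> DF y"
    and safe: "\<And>y. \<lbrakk>(x, y) \<notin> unsafe; y \<in> K; \<beta> \<le> F y\<rbrakk> \<Longrightarrow> 0 < D\<phi> x \<bullet> DF y"
    and contF: "continuous_on K F"
  shows "F (euler s x) \<le> \<beta>"
proof (rule ccontr)
  assume above: "\<not> ?thesis"
  have in_K: "euler r x \<in> interior K" if "r \<in> {0..1}" for r
    using euler_safe[OF x(1,2), of r] that x by (auto simp: unsafe_def)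
  define R where "R = {r \<in> {0..s}. F (euler r x) \<le> \<beta>}"
  have "continuous_on {0..s} (\<lambda>r. F (euler r x))"
  proof (rule continuous_on_compose2[OF contF])
    show "continuous_on {0..s} (\<lambda>r. euler r x)"
      unfolding euler_def by (intro continuous_intros)
    show "(\<lambda>r. euler r x) ` {0..s} \<subseteq> K"
      using s in_K interior_subset by fastforce
  qed
  then have "closed R"
    unfolding R_def by (intro continuous_on_closed_Collect_le continuous_intros) auto
  moreover have "bounded R"
    by (rule bounded_subset[OF bounded_closed_interval[of 0 s]]) (auto simp: R_def)
  ultimately have "compact R"
    by (simp add: compact_eq_bounded_closed)
  moreover have "0 \<in> R"
    using x s by (simp add: R_def euler_def)
  ultimately obtain q where q: "q \<in> R" "\<And>r. r \<in> R \<Longrightarrow> r \<le> q"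
    using compact_attains_sup[of R] by (metis empty_iff)
  then have "q \<le> s" "q \<noteq> s"
    using above by (auto simp: R_def)
  then have "q < s" by simp
  obtain r where r: "q < r" "r < s"
    "F (euler s x) - F (euler q x) = - ((s - q) * step_size x * (D\<phi> x \<bullet> DF (euler r x)))"
    using euler_mvt[OF x(1,2) _ \<open>q < s\<close> _ F] q s by (auto simp: R_def)
  have "\<beta> < F (euler r x)"
    using q(2)[of r] q(1) r by (force simp: R_def)
  then have "0 < D\<phi> x \<bullet> DF (euler r x)"
    using q(1) r s in_K[of r] euler_safe[OF x(1,2), of r] interior_subset
    by (intro safe) (auto simp: R_def)
  then have "F (euler s x) < F (euler q x)"
    using r \<open>q < s\<close> x by (smt (verit) mult_pos_pos)
  then show False
    using above q(1) by (simp add: R_def)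
qed

lemma euler_W:
  assumes "x \<in> W" "s \<in> {0..1}"
  shows "euler s x \<in> W"
proof (cases "0 < step_size x")
  case True
  have x: "x \<in> K" "f x \<le> b" "g x \<le> \<mu>"
    using assms by (auto simp: W_def)
  have "euler s x \<in> K"
    using euler_safe[OF x(1) True assms(2)] x interior_subset by (auto simp: unsafe_def)
  moreover have "f (euler s x) \<le> b"
    using euler_constraint[OF x(1) True x(2) assms(2) deriv(2) _ cont(2)] x(1)
    by (force simp: unsafe_def)
  moreover have "g (euler s x) \<le> \<mu>"
    using euler_constraint[OF x(1) True x(3) assms(2) deriv(3) _ cont(3)] x(1)
    by (force simp: unsafe_def)
  ultimately show ?thesis by (simp add: W_def)
qed (use assms euler_no_step in auto)

text \<open>An Armijo estimate: safety preserves half of the initial descent rate, whence the factor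
  2.\<close>

lemma euler_decrease:
  assumes x: "x \<in> K" and s: "s \<in> {0..1}"
  shows "s * step_size x * (D\<phi> x \<bullet> D\<phi> x) \<le> 2 * (\<phi> x - \<phi> (euler s x))"
proof (cases "0 < step_size x \<and> 0 < s")
  case True
  then obtain r where r: "0 < r" "r < s"
    "\<phi> (euler s x) - \<phi> (euler 0 x) = - ((s - 0) * step_size x * (D\<phi> x \<bullet> D\<phi> (euler r x)))"
    using euler_mvt[OF x _ _ _ _ deriv(1), of 0 s] s by auto
  have "(x, euler r x) \<notin> unsafe"
    using True r s x by (intro euler_safe) auto
  then have "(D\<phi> x \<bullet> D\<phi> x) / 2 \<le> D\<phi> x \<bullet> D\<phi> (euler r x)"
    using x interior_subset by (force simp: unsafe_def)
  then have "s * step_size x * ((D\<phi> x \<bullet> D\<phi> x) / 2) \<le> s * step_size x * (D\<phi> x \<bullet> D\<phi> (euler r x))"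
    using True by (intro mult_left_mono) auto
  then show ?thesis
    using r(3) by (simp add: euler_def[of 0])
next
  case False
  then have "s = 0 \<or> step_size x = 0"
    using s step_size_nonneg[of x] by force
  then show ?thesis by (auto simp: euler_def)
qed

lemma euler_le: "\<lbrakk>x \<in> K; s \<in> {0..1}\<rbrakk> \<Longrightarrow> \<phi> (euler s x) \<le> \<phi> x"
  using euler_decrease[of x s] step_size_nonneg[of x]
  by (smt (verit) atLeastAtMost_iff inner_ge_zero mult_nonneg_nonneg)

lemma euler_less:
  assumes "x \<in> X" "a < \<phi> x" "0 < s" "s \<le> 1"
  shows "\<phi> (euler s x) < \<phi> x"
proof -
  have "x \<in> K" "x \<noteq> 0"
    using assms X_sub zero_in by auto
  then have "0 < s * step_size x * (D\<phi> x \<bullet> D\<phi> x)"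
    using zero step_size_pos[OF assms(1,2)] assms by (intro mult_pos_pos) auto
  then show ?thesis
    using euler_decrease[of x s] \<open>x \<in> K\<close> assms by simp
qed

lemma euler_X:
  assumes x: "x \<in> X" and s: "s \<in> {0..1}"
  shows "euler s x \<in> X"
proof (cases "0 < s \<and> a < \<phi> x")
  case True
  have "euler s x \<in> W"
    using euler_W x s X_sub by (auto simp: W_def)
  \<comment> \<open>A removed origin cannot be hit: \<phi> drops strictly from a value that is at
    most \<open>\<phi> 0\<close>.\<close>
  moreover have "euler s x \<noteq> 0" if "0 \<notin> X"
  proof
    assume "euler s x = 0"
    then have "g 0 \<le> \<mu>" "f 0 \<le> b"
      using \<open>euler s x \<in> W\<close> by (auto simp: W_def)
    then show False
      using zero_out(2)[OF _ _ that x] euler_less[OF x, of s] True s \<open>euler s x = 0\<close> by auto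
  qed
  ultimately show ?thesis
    using sub_X by (auto simp: W_def)
next
  case False
  then have "s = 0 \<or> step_size x \<le> 0"
    using s x X_sub step_size_level by force
  then show ?thesis
    using x by (auto simp: euler_no_step) (simp add: euler_def)
qed

text \<open>The level \<open>a\<close> is only approached asymptotically, so the total decrease
  along a chain is bounded by its initial height above \<open>a\<close>.\<close>

lemma euler_above: "\<lbrakk>x \<in> K; s \<in> {0..1}; a < \<phi> x\<rbrakk> \<Longrightarrow> a < \<phi> (euler s x)"
proof (cases "0 < step_size x")
  case True
  assume x: "x \<in> K" "s \<in> {0..1}" "a < \<phi> x"
  then show ?thesis
    using euler_safe[OF x(1) True x(2)] interior_subset by (force simp: unsafe_def)
qed (simp add: euler_no_step)

text \<open>Away from 0 the gradient is bounded below, so path length is at most a constant times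
  the decrease of \<phi>. Near 0 single steps are short, and a chain that visits a small ball around
  0 must start and remain close to it.\<close>

lemma euler_chain_small:
  assumes e: "e > 0"
  shows "\<exists>d>0. \<forall>y m. (\<forall>k. y k \<in> X \<and> (\<exists>s\<in>{0..1}. y (Suc k) = euler s (y k)))
                          \<longrightarrow> \<phi> (y 0) < a + d \<longrightarrow> dist (y m) (y 0) < e"
proof -
  \<comment> \<open>The two cases below give total bounds \<open>r\<close> and \<open>5 * r\<close>,
    both less than \<open>e\<close>.\<close>
  define r where "r = e / 8"
  have "r > 0" using e by (simp add: r_def)
  obtain q where q: "q > 0" "q \<le> r" and q_small: "\<And>x. \<lbrakk>x \<in> K; norm x < q\<rbrakk> \<Longrightarrow> norm (D\<phi> x) < r"
  proof -
    obtain q where "q > 0" "\<And>x. \<lbrakk>x \<in> K; dist x 0 < q\<rbrakk> \<Longrightarrow> dist (D\<phi> x) (D\<phi> 0) < r"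
      using cont_D(1) zero(1) \<open>r > 0\<close> unfolding continuous_on_iff by metis
    then show thesis
      using \<open>r > 0\<close> zero by (intro that[of "min q r"]) (auto simp: dist_norm)
  qed
  obtain m0 where "m0 > 0" and m0: "\<And>x. \<lbrakk>x \<in> K; q \<le> norm x\<rbrakk> \<Longrightarrow> m0 \<le> norm (D\<phi> x)"
  proof (cases "K - ball 0 q = {}")
    case True
    then show thesis by (intro that[of 1]) auto
  next
    case False
    moreover have "compact (K - ball 0 q)"
      using compact_K by (intro compact_diff) auto
    moreover have "continuous_on (K - ball 0 q) (\<lambda>x. norm (D\<phi> x))"
      using cont_D(1) by (intro continuous_on_norm) (auto intro: continuous_on_subset)
    ultimately obtain z where z: "z \<in> K - ball 0 q" "\<And>x. x \<in> K - ball 0 q \<Longrightarrow> norm (D\<phi> z) \<le> norm (D\<phi> x)"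
      using continuous_attains_inf by metis
    then show thesis
      using zero(3)[of z] q by (intro that[of "norm (D\<phi> z)"]) auto
  qed
  define C where "C = 2 / m0"
  have "C > 0" using \<open>m0 > 0\<close> by (simp add: C_def)
  \<comment> \<open>Starting less than \<open>d\<close> above level \<open>a\<close>, the chain
    spends at most \<open>r\<close> of path length outside the \<open>q\<close>-ball.\<close>
  define d where "d = r / C"
  have "d > 0" "C * d = r" using \<open>r > 0\<close> \<open>C > 0\<close> by (auto simp: d_def)
  have far: "dist (euler s x) x \<le> C * (\<phi> x - \<phi> (euler s x))"
    if "x \<in> K" "s \<in> {0..1}" "q \<le> norm x" for s x
  proof -
    have "dist (euler s x) x * m0 \<le> dist (euler s x) x * norm (D\<phi> x)"
      using m0 that by (intro mult_left_mono) auto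
    also have "\<dots> = s * step_size x * (D\<phi> x \<bullet> D\<phi> x)"
      using that step_size_nonneg
      by (simp add: euler_def dist_norm dot_square_norm power2_eq_square)
    also have "\<dots> \<le> 2 * (\<phi> x - \<phi> (euler s x))"
      using that by (intro euler_decrease)
    finally show ?thesis
      using \<open>m0 > 0\<close> by (simp add: C_def field_simps)
  qed
  have near: "dist (euler s x) x < r" if "x \<in> K" "s \<in> {0..1}" "norm x < q" for s x
  proof -
    have "dist (euler s x) x = s * step_size x * norm (D\<phi> x)"
      using that step_size_nonneg by (simp add: euler_def dist_norm)
    also have "\<dots> \<le> 1 * norm (D\<phi> x)"
      using that step_size_nonneg[of x] by (intro mult_right_mono mult_le_one) (auto simp: step_size_def)
    also have "\<dots> < r"
      using q_small that by simp
    finally show ?thesis .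
  qed
  have "dist (y m) (y 0) < e"
    if y: "\<And>k. y k \<in> X" "\<And>k. \<exists>s\<in>{0..1}. y (Suc k) = euler s (y k)" and less: "\<phi> (y 0) < a + d" for y m
  proof (cases "\<phi> (y 0) \<le> a")
    case True
    have "y m = y 0"
      using True
      by (induction m) (use y X_sub step_size_level euler_no_step in \<open>metis (no_types, lifting) mem_Collect_eq subset_iff\<close>)+
    then show ?thesis using e by simp
  next
    case False
    have yK: "y k \<in> K" for k
      using y X_sub by auto
    have above: "a < \<phi> (y k)" for k
      by (induction k) (use False euler_above y(2) yK in \<open>auto, metis\<close>)
    have drop: "C * (\<phi> (y 0) - \<phi> (y k)) \<le> r" for k
    proof -
      have "C * (\<phi> (y 0) - \<phi> (y k)) \<le> C * d"
        using above[of k] less \<open>C > 0\<close> by (intro mult_left_mono) auto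
      then show ?thesis using \<open>C * d = r\<close> by simp
    qed
    \<comment> \<open>The first alternative describes chains that have not yet made a step from
      inside the \<open>q\<close>-ball. Such a step gives the second: the earlier travel was at most
      \<open>r\<close>, so \<open>y 0\<close> has norm at most \<open>q + r\<close>, and the new
      point has norm at most \<open>q + r\<close>.\<close>
    have "dist (y m) (y 0) \<le> C * (\<phi> (y 0) - \<phi> (y m)) \<or>
        norm (y 0) \<le> 2 * r \<and> norm (y m) \<le> 2 * r + C * (\<phi> (y 0) - \<phi> (y m))"
    proof (induction m)
      case (Suc m)
      obtain s where s: "s \<in> {0..1}" "y (Suc m) = euler s (y m)"
        using y(2) by blast
      show ?case
      proof (cases "q \<le> norm (y m)")
        case True
        then have "dist (y (Suc m)) (y m) \<le> C * (\<phi> (y m) - \<phi> (y (Suc m)))"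
          using far[OF yK s(1)] s by simp
        moreover have "norm (y (Suc m)) \<le> norm (y m) + dist (y (Suc m)) (y m)"
          by (metis dist_norm norm_triangle_sub)
        moreover have "dist (y (Suc m)) (y 0) \<le> dist (y (Suc m)) (y m) + dist (y m) (y 0)"
          by (rule dist_triangle)
        ultimately show ?thesis
          using Suc.IH by (auto simp: algebra_simps)
      next
        case False
        then have "dist (y (Suc m)) (y m) < r"
          using near[OF yK s(1), of m] s by simp
        moreover have "norm (y (Suc m)) \<le> norm (y m) + dist (y (Suc m)) (y m)"
          by (metis dist_norm norm_triangle_sub)
        moreover have "norm (y 0) \<le> norm (y m) + dist (y m) (y 0)"
          by (metis dist_norm dist_commute norm_triangle_sub)
        moreover have "0 \<le> C * (\<phi> (y 0) - \<phi> (y (Suc m)))"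
        proof -
          have "antimono (\<lambda>k. \<phi> (y k))"
            by (rule decseq_SucI) (use y(2) yK euler_le in metis)
          then have "\<phi> (y (Suc m)) \<le> \<phi> (y 0)"
            by (rule decseqD) simp
          then show ?thesis
            using \<open>C > 0\<close> by simp
        qed
        ultimately show ?thesis
          using Suc.IH False q drop[of m] by auto
      qed
    qed simp
    moreover have "dist (y m) (y 0) \<le> norm (y m) + norm (y 0)"
      by (simp add: dist_norm norm_triangle_ineq4)
    ultimately show ?thesis
      using drop[of m] e unfolding r_def by auto
  qed
  with \<open>d > 0\<close> show ?thesis by blast
qed

lemma descent_euler: "descent W X euler \<phi> a"
proof
  show "compact W"
  proof -
    have "W = {x \<in> K. g x \<le> \<mu>} \<inter> {x \<in> K. f x \<le> b}"
      by (auto simp: W_def)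
    moreover have "closed {x \<in> K. g x \<le> \<mu>}" "closed {x \<in> K. f x \<le> b}"
      using compact_imp_closed[OF compact_K] cont
      by (auto intro!: continuous_on_closed_Collect_le continuous_intros)
    ultimately have "closed W" by auto
    then show ?thesis
      using compact_K by (metis (no_types, lifting) W_def closed_Int_compact inf.absorb_iff1 mem_Collect_eq subsetI)
  qed
  show "X \<subseteq> W"
    using X_sub by (simp add: W_def)
  have WK: "W \<subseteq> K"
    by (auto simp: W_def)
  show "continuous_on W \<phi>"
    using cont(1) WK by (rule continuous_on_subset)
  show "continuous_on ({0..1} \<times> W) (\<lambda>(s,x). euler s x)"
    unfolding euler_def case_prod_unfold
    by (intro continuous_intros continuous_on_compose2[OF cont_D(1)] continuous_on_compose2[OF continuous_on_step_size])
      (use WK in auto)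
  show "\<phi> (euler 1 x) < \<phi> y \<and> a < \<phi> y" if "x \<in> X" "y \<in> W - X" for x y
  proof -
    \<comment> \<open>Only the origin can be missing from \<open>X\<close>. If
      \<open>a < \<phi> x\<close>, the strict decrease puts the new value below
      \<open>\<phi> 0\<close>; otherwise it is at most \<open>a\<close>, which is less than
      \<open>\<phi> 0\<close>.\<close>
    have y: "y = 0" "g 0 \<le> \<mu>" "f 0 \<le> b" "0 \<notin> X"
      using that sub_X by (auto simp: W_def)
    have K: "x \<in> K" using that X_sub by auto
    show ?thesis
      using zero_out[OF y(2,3,4)] that y(1) euler_less[OF that(1), of 1] euler_le[OF K, of 1]
      by (cases "a < \<phi> x") force+
  qed
  show "euler s x = x" if "x \<in> X" "\<phi> x \<le> a" for s x
    using that X_sub step_size_level euler_no_step by auto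
  show "euler 0 x = x" for x
    by (simp add: euler_def)
  show "\<phi> (euler s x) \<le> \<phi> x" if "s \<in> {0..1}" "x \<in> X" for s x
    using that X_sub euler_le by auto
qed (use euler_W euler_X euler_less euler_chain_small in auto)

lemma trivial_relative_homology_sublevel:
  "trivial_group (relative_homology_group p (top_of_set X) {x \<in> X. \<phi> x \<le> a})"
  using descent.trivial_relative_homology[OF descent_euler] .

end

section \<open>Stability of isolated critical points\<close>

definition isolated_critical_on :: "'a::euclidean_space set \<Rightarrow> ('a \<Rightarrow> real) \<Rightarrow> ('a \<Rightarrow> 'a) \<Rightarrow> bool" where
  "isolated_critical_on K f Df \<longleftrightarrow> continuous_on K f \<and> continuous_on K Df \<and>
     (\<forall>x\<in>interior K. GDERIV f x :> Df x) \<and> f 0 = 0 \<and> Df 0 = 0 \<and> (\<forall>x\<in>K. Df x = 0 \<longrightarrow> x = 0)"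

lemma compact_norm_lower_bound:
  fixes F :: "'a::topological_space \<Rightarrow> 'b::real_normed_vector"
  assumes "compact S" "continuous_on S F" "\<And>x. x \<in> S \<Longrightarrow> F x \<noteq> 0"
  obtains m where "m > 0" "\<And>x. x \<in> S \<Longrightarrow> m \<le> norm (F x)"
proof (cases "S = {}")
  case True
  then show thesis by (intro that[of 1]) auto
next
  case False
  then obtain z where "z \<in> S" "\<And>x. x \<in> S \<Longrightarrow> norm (F z) \<le> norm (F x)"
    using continuous_attains_inf[OF assms(1) _ continuous_on_norm[OF assms(2)]] by metis
  then show thesis
    using assms(3) by (intro that[of "norm (F z)"]) auto
qed

text \<open>Both groups are identified with the homology of one pair \<open>(C, Y)\<close> built
  from \<open>f0\<close> alone, inside the neighbourhood \<open>N\<close> given by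
  \<open>g \<le> \<mu>\<close>.\<close>

lemma local_critical_homology_stable:
  fixes f0 :: "'a::euclidean_space \<Rightarrow> real"
  assumes "\<rho> > 0" and crit0: "isolated_critical_on (cball 0 \<rho>) f0 Df0"
  shows "\<exists>\<eta>>0. \<exists>N. 0 \<in> interior N \<and>
    (\<forall>f Df p. isolated_critical_on (cball 0 \<rho>) f Df \<longrightarrow>
        (\<forall>x\<in>cball 0 \<rho>. \<bar>f x - f0 x\<bar> \<le> \<eta> \<and> norm (Df x - Df0 x) \<le> \<eta>) \<longrightarrow>
      relative_homology_group p (top_of_set ({x. f x \<le> 0} \<inter> N)) ({x. f x \<le> 0} \<inter> N - {0}) \<cong>
      relative_homology_group p (top_of_set ({x. f0 x \<le> 0} \<inter> N)) ({x. f0 x \<le> 0} \<inter> N - {0}))"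
proof -
  let ?K = "cball (0::'a) \<rho>"
  have f0: "continuous_on ?K f0" "continuous_on ?K Df0" "\<And>x. x \<in> ball 0 \<rho> \<Longrightarrow> GDERIV f0 x :> Df0 x"
    "f0 0 = 0" "Df0 0 = 0" "\<And>x. x \<in> ?K \<Longrightarrow> Df0 x = 0 \<Longrightarrow> x = 0"
    using crit0 by (auto simp: isolated_critical_on_def)
  obtain m where "m > 0" and m: "\<And>x. \<lbrakk>\<rho> / 2 \<le> norm x; norm x \<le> \<rho>\<rbrakk> \<Longrightarrow> m \<le> norm (Df0 x)"
  proof (rule compact_norm_lower_bound[of "?K - ball 0 (\<rho> / 2)" Df0])
    show "compact (?K - ball 0 (\<rho> / 2))" by (intro compact_diff) auto
    show "continuous_on (?K - ball 0 (\<rho> / 2)) Df0"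
      using f0(2) by (rule continuous_on_subset) auto
    show "Df0 x \<noteq> 0" if "x \<in> ?K - ball 0 (\<rho> / 2)" for x
      using f0(6)[of x] that \<open>\<rho> > 0\<close> by auto
  qed auto
  \<comment> \<open>Chosen so that in \<open>Df0 x \<bullet> Dg x\<close> the term from
    \<open>f0\<close> dominates the one from the squared norm when \<open>norm (Df0 x)\<close> is at
    least \<open>m\<close>.\<close>
  define \<kappa> where "\<kappa> = (2 * \<rho> + 1) / m"
  have "\<kappa> > 0" "\<kappa> * m = 2 * \<rho> + 1"
    using \<open>m > 0\<close> \<open>\<rho> > 0\<close> by (auto simp: \<kappa>_def)
  \<comment> \<open>For \<open>\<bar>f0 x\<bar> \<le> 2 * \<gamma>\<close> the term
    \<open>\<kappa> * f0 x\<close> is at most a quarter of \<open>\<rho>\<^sup>2\<close>, so the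
    level \<open>g = \<mu>\<close> lies in the shell where \<open>m\<close> bounds the gradient and
    strictly inside the ball.\<close>
  define \<gamma> where "\<gamma> = \<rho>\<^sup>2 / (8 * \<kappa>)"
  have "\<gamma> > 0" and \<kappa>\<gamma>: "\<kappa> * \<gamma> = \<rho>\<^sup>2 / 8"
    using \<open>\<kappa> > 0\<close> \<open>\<rho> > 0\<close> by (auto simp: \<gamma>_def)
  define \<mu> where "\<mu> = \<rho>\<^sup>2 / 2"
  define g where "g x = \<kappa> * f0 x + x \<bullet> x" for x
  define Dg where "Dg x = \<kappa> *\<^sub>R Df0 x + 2 *\<^sub>R x" for x
  have g_cont: "continuous_on ?K g" "continuous_on ?K Dg"
    unfolding g_def Dg_def by (intro continuous_intros f0)+
  have g_deriv: "GDERIV g x :> Dg x" if "x \<in> ball 0 \<rho>" for x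
    using f0(3)[OF that] unfolding g_def Dg_def gderiv_def
    by (auto intro!: derivative_eq_intros simp: fun_eq_iff inner_simps inner_commute algebra_simps)
  have inner_ball: "norm x < \<rho>" if "g x \<le> \<mu>" "- (2 * \<gamma>) \<le> f0 x" for x
  proof -
    have "\<kappa> * (- (2 * \<gamma>)) \<le> \<kappa> * f0 x"
      using that \<open>\<kappa> > 0\<close> by (intro mult_left_mono) auto
    then have "(norm x)\<^sup>2 \<le> 3 / 4 * \<rho>\<^sup>2"
      using that \<kappa>\<gamma> by (simp add: g_def \<mu>_def power2_norm_eq_inner)
    also have "\<dots> < \<rho>\<^sup>2"
      using \<open>\<rho> > 0\<close> by simp
    finally show ?thesis
      using \<open>\<rho> > 0\<close> by (simp add: power_less_imp_less_base)
  qed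
  have inward0: "m \<le> Df0 x \<bullet> Dg x" if "g x = \<mu>" "\<bar>f0 x\<bar> \<le> 2 * \<gamma>" for x
  proof -
    have "\<kappa> * f0 x \<le> \<kappa> * (2 * \<gamma>)"
      using that \<open>\<kappa> > 0\<close> by (intro mult_left_mono) auto
    then have "(\<rho> / 2)\<^sup>2 \<le> (norm x)\<^sup>2"
      using that \<kappa>\<gamma> by (simp add: g_def \<mu>_def power2_norm_eq_inner power_divide)
    then have "\<rho> / 2 \<le> norm x"
      by (rule power2_le_imp_le) simp
    moreover have "norm x < \<rho>"
      using inner_ball[of x] that by simp
    ultimately have mx: "m \<le> norm (Df0 x)"
      using m by auto
    have "m * 1 \<le> norm (Df0 x) * (\<kappa> * norm (Df0 x) - 2 * \<rho>)"
    proof (intro mult_mono)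
      show "1 \<le> \<kappa> * norm (Df0 x) - 2 * \<rho>"
        using mult_left_mono[OF mx, of \<kappa>] \<open>\<kappa> > 0\<close> \<open>\<kappa> * m = 2 * \<rho> + 1\<close> by simp
    qed (use mx in auto)
    also have "\<dots> \<le> norm (Df0 x) * (\<kappa> * norm (Df0 x) - 2 * norm x)"
      using \<open>norm x < \<rho>\<close> by (intro mult_left_mono) auto
    also have "\<dots> = \<kappa> * (Df0 x \<bullet> Df0 x) - 2 * (norm (Df0 x) * norm x)"
      by (simp add: dot_square_norm power2_eq_square algebra_simps)
    also have "\<dots> \<le> \<kappa> * (Df0 x \<bullet> Df0 x) + 2 * (Df0 x \<bullet> x)"
      using Cauchy_Schwarz_ineq2[of "Df0 x" x] by linarith
    finally show ?thesis
      by (simp add: Dg_def inner_simps)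
  qed
  obtain M where M: "M > 0" "\<And>x. x \<in> ?K \<Longrightarrow> norm (Dg x) \<le> M"
    using compact_imp_bounded[OF compact_continuous_image[OF g_cont(2) compact_cball]]
    unfolding bounded_pos by blast
  \<comment> \<open>The set stays away from 0, the only zero of \<open>Df0\<close>, because
    \<open>f0 0 = 0\<close>.\<close>
  obtain m1 where "m1 > 0" and m1: "\<And>x. \<lbrakk>x \<in> ?K; \<gamma> / 2 \<le> \<bar>f0 x\<bar>\<rbrakk> \<Longrightarrow> m1 \<le> norm (Df0 x)"
  proof (rule compact_norm_lower_bound[of "{x \<in> ?K. \<gamma> / 2 \<le> \<bar>f0 x\<bar>}" Df0])
    have "closed {x \<in> ?K. \<gamma> / 2 \<le> \<bar>f0 x\<bar>}"
      by (intro continuous_on_closed_Collect_le continuous_intros f0) auto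
    then show "compact {x \<in> ?K. \<gamma> / 2 \<le> \<bar>f0 x\<bar>}"
      unfolding compact_eq_bounded_closed
      by (intro conjI) (rule bounded_subset[OF bounded_cball[of 0 \<rho>]], auto)
    show "continuous_on {x \<in> ?K. \<gamma> / 2 \<le> \<bar>f0 x\<bar>} Df0"
      using f0(2) by (rule continuous_on_subset) auto
    show "Df0 x \<noteq> 0" if "x \<in> {x \<in> ?K. \<gamma> / 2 \<le> \<bar>f0 x\<bar>}" for x
      using f0(6)[of x] f0(4) that \<open>\<gamma> > 0\<close> by auto
  qed auto
  \<comment> \<open>The three bounds respectively keep the levels 0 and \<plusminus>\<gamma> apart
    after perturbation, keep \<open>Df\<close> and \<open>Df0\<close> at an acute angle off the zero
    level, and preserve the inward direction along \<open>g = \<mu>\<close>.\<close>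
  define \<eta> where "\<eta> = min (\<gamma> / 2) (min (m1 / 2) (m / (2 * M)))"
  have \<eta>: "\<eta> > 0" "\<eta> \<le> \<gamma> / 2" "\<eta> < m1" "\<eta> * M < m"
  proof -
    show "\<eta> > 0" "\<eta> \<le> \<gamma> / 2" "\<eta> < m1"
      using \<open>\<gamma> > 0\<close> \<open>m1 > 0\<close> \<open>m > 0\<close> \<open>M > 0\<close> by (auto simp: \<eta>_def)
    have "\<eta> * M \<le> m / (2 * M) * M"
      using \<open>M > 0\<close> by (intro mult_right_mono) (auto simp: \<eta>_def)
    then show "\<eta> * M < m"
      using \<open>M > 0\<close> \<open>m > 0\<close> by simp
  qed
  define N where "N = {x \<in> ?K. g x \<le> \<mu>}"
  \<comment> \<open>The shifts by \<eta> put \<open>C\<close> inside \<open>f \<le> \<gamma>\<close>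
    and \<open>Y\<close> inside \<open>f \<le> - \<gamma>\<close> for every admissible
    \<open>f\<close>.\<close>
  define C where "C = {x \<in> N. f0 x \<le> \<gamma> - \<eta>}"
  define Y where "Y = {x \<in> N. f0 x \<le> - \<gamma> - \<eta>}"
  have key: "relative_homology_group p (top_of_set ({x. f x \<le> 0} \<inter> N)) ({x. f x \<le> 0} \<inter> N - {0}) \<cong>
      relative_homology_group p (top_of_set C) Y"
    if crit: "isolated_critical_on ?K f Df" and close: "\<And>x. x \<in> ?K \<Longrightarrow> \<bar>f x - f0 x\<bar> \<le> \<eta>"
      and close_D: "\<And>x. x \<in> ?K \<Longrightarrow> norm (Df x - Df0 x) \<le> \<eta>" for f Df p
  proof -
    have f: "continuous_on ?K f" "continuous_on ?K Df" "\<And>x. x \<in> ball 0 \<rho> \<Longrightarrow> GDERIV f x :> Df x"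
      "f 0 = 0" "Df 0 = 0" "\<And>x. x \<in> ?K \<Longrightarrow> Df x = 0 \<Longrightarrow> x = 0"
      using crit by (auto simp: isolated_critical_on_def)
    have g0: "g 0 \<le> \<mu>"
      by (simp add: g_def \<mu>_def f0)
    have inward: "0 < Df x \<bullet> Dg x" if "x \<in> ?K" "g x = \<mu>" "\<bar>f0 x\<bar> \<le> 2 * \<gamma>" for x
    proof -
      have "\<bar>(Df x - Df0 x) \<bullet> Dg x\<bar> \<le> norm (Df x - Df0 x) * norm (Dg x)"
        by (rule Cauchy_Schwarz_ineq2)
      also have "\<dots> \<le> \<eta> * M"
        using close_D M that \<eta> by (intro mult_mono) auto
      finally show ?thesis
        using inward0[OF that(2,3)] \<eta>(4) by (simp add: inner_diff_left)
    qed
    have aligned: "0 < Df0 x \<bullet> Df x" if "x \<in> ?K" "\<gamma> / 2 \<le> \<bar>f0 x\<bar>" for x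
    proof -
      have "\<bar>Df0 x \<bullet> (Df x - Df0 x)\<bar> \<le> norm (Df0 x) * norm (Df x - Df0 x)"
        by (rule Cauchy_Schwarz_ineq2)
      also have "\<dots> \<le> norm (Df0 x) * \<eta>"
        using close_D that by (intro mult_left_mono) auto
      also have "\<dots> < norm (Df0 x) * norm (Df0 x)"
        using m1[OF that] \<eta>(3) \<open>m1 > 0\<close> by (intro mult_strict_left_mono) auto
      finally show ?thesis
        by (simp add: inner_diff_right dot_square_norm power2_eq_square)
    qed
    have self: "0 < Df x \<bullet> Df x" if "x \<in> ?K" "x \<noteq> 0" for x
      using f(6) that by auto
    define S where "S b = {x \<in> ?K. g x \<le> \<mu> \<and> f x \<le> b}" for b
    have S0: "{x. f x \<le> 0} \<inter> N = S 0"
      by (auto simp: S_def N_def)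
    have le: "f0 x \<le> f x + \<eta>" "f x \<le> f0 x + \<eta>" if "x \<in> ?K" for x
      using close[OF that] by auto
    have lower: "f0 x \<le> \<gamma> - \<eta> \<Longrightarrow> f x \<le> \<gamma>" "f0 x \<le> - \<gamma> - \<eta> \<Longrightarrow> f x \<le> - \<gamma>" if "x \<in> ?K" for x
      using le[OF that] by auto
    have triv_gen: "trivial_group (relative_homology_group p (top_of_set X) {x \<in> X. \<phi> x \<le> a})"
      if \<phi>: "isolated_critical_on ?K \<phi> D\<phi>" and X: "X \<subseteq> S b" "S b - {0} \<subseteq> X" "0 \<in> X \<Longrightarrow> 0 \<le> a"
        "\<lbrakk>0 \<le> b; 0 \<notin> X\<rbrakk> \<Longrightarrow> a < 0" "\<And>x. \<lbrakk>0 \<le> b; 0 \<notin> X; x \<in> X\<rbrakk> \<Longrightarrow> \<phi> x \<le> 0"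
        and moving: "\<And>x. \<lbrakk>x \<in> X; a < \<phi> x\<rbrakk> \<Longrightarrow> - (2 * \<gamma>) \<le> f0 x"
          "\<And>x. \<lbrakk>x \<in> X; a < \<phi> x; f x = b\<rbrakk> \<Longrightarrow> 0 < D\<phi> x \<bullet> Df x"
          "\<And>x. \<lbrakk>x \<in> X; a < \<phi> x; g x = \<mu>\<rbrakk> \<Longrightarrow> 0 < D\<phi> x \<bullet> Dg x"
      for \<phi> D\<phi> X a b p
    proof -
      interpret euler_descent ?K X \<phi> f g D\<phi> Df Dg a b \<mu>
      proof
        show "x \<in> interior ?K" if "x \<in> X" "a < \<phi> x" for x
          using inner_ball[of x] moving(1)[OF that] X(1) that by (auto simp: S_def)
      qed (use \<phi> X moving f g_cont g_deriv g0 \<open>\<rho> > 0\<close> in \<open>auto simp: S_def isolated_critical_on_def\<close>)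
      show ?thesis
        by (rule trivial_relative_homology_sublevel)
    qed
    \<comment> \<open>First deformation, along \<open>f\<close>; here the critical point lies on the
      target level itself.\<close>
    have "trivial_group (relative_homology_group p (top_of_set (S \<gamma>)) {x \<in> S \<gamma>. f x \<le> 0})" for p
    proof (rule triv_gen[where b = \<gamma>, OF crit])
      fix x assume x: "x \<in> S \<gamma>" "0 < f x"
      then have K: "x \<in> ?K" "f x \<le> \<gamma>"
        by (auto simp: S_def)
      show "- (2 * \<gamma>) \<le> f0 x"
        using le[OF K(1)] x \<eta> by simp
      show "0 < Df x \<bullet> Df x"
        using self[OF K(1)] x(2) f(4) by (metis less_irrefl)
      show "0 < Df x \<bullet> Dg x" if "g x = \<mu>"
        using le[OF K(1)] K x \<eta> by (intro inward that) auto
    qed (use \<open>\<gamma> > 0\<close> \<open>\<rho> > 0\<close> f(4) g0 in \<open>auto simp: S_def\<close>)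
    \<comment> \<open>Second deformation, along \<open>f\<close> with the critical point removed; it
      sits at the top level 0, above the target.\<close>
    moreover have "trivial_group (relative_homology_group p (top_of_set (S 0 - {0})) {x \<in> S 0 - {0}. f x \<le> - \<gamma>})" for p
    proof (rule triv_gen[where b = 0, OF crit])
      fix x assume x: "x \<in> S 0 - {0}" "- \<gamma> < f x"
      then have K: "x \<in> ?K" "f x \<le> 0" "x \<noteq> 0"
        by (auto simp: S_def)
      show "- (2 * \<gamma>) \<le> f0 x"
        using le[OF K(1)] x \<eta> by simp
      show "0 < Df x \<bullet> Df x"
        using self K by auto
      show "0 < Df x \<bullet> Dg x" if "g x = \<mu>"
        using le[OF K(1)] K x \<eta> by (intro inward that) auto
    qed (use \<open>\<gamma> > 0\<close> in \<open>auto simp: S_def\<close>)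
    \<comment> \<open>The last two deformations descend along \<open>f0\<close> while
      \<open>f\<close> is a constraint; by the choice of \<eta> the moving points satisfy
      \<open>\<gamma> / 2 \<le> \<bar>f0 x\<bar>\<close>, where the gradients are aligned.\<close>
    moreover have "trivial_group (relative_homology_group p (top_of_set (S \<gamma>)) {x \<in> S \<gamma>. f0 x \<le> \<gamma> - \<eta>})" for p
    proof (rule triv_gen[where b = \<gamma>, OF crit0])
      fix x assume x: "x \<in> S \<gamma>" "\<gamma> - \<eta> < f0 x"
      then have K: "x \<in> ?K" "f x \<le> \<gamma>"
        by (auto simp: S_def)
      show "- (2 * \<gamma>) \<le> f0 x"
        using x \<eta> \<open>\<gamma> > 0\<close> by simp
      show "0 < Df0 x \<bullet> Df x"
        using x \<eta> K by (intro aligned) auto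
      show "0 < Df0 x \<bullet> Dg x" if "g x = \<mu>"
        using inward0[of x] that le[OF K(1)] K x \<eta> \<open>m > 0\<close> by simp
    qed (use \<open>\<gamma> > 0\<close> \<open>\<rho> > 0\<close> \<eta> f(4) g0 in \<open>auto simp: S_def\<close>)
    moreover have "trivial_group (relative_homology_group p (top_of_set (S (- \<gamma>))) {x \<in> S (- \<gamma>). f0 x \<le> - \<gamma> - \<eta>})" for p
    proof (rule triv_gen[where b = "- \<gamma>", OF crit0])
      fix x assume x: "x \<in> S (- \<gamma>)" "- \<gamma> - \<eta> < f0 x"
      then have K: "x \<in> ?K" "f x \<le> - \<gamma>"
        by (auto simp: S_def)
      show "- (2 * \<gamma>) \<le> f0 x"
        using x \<eta> \<open>\<gamma> > 0\<close> by simp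
      show "0 < Df0 x \<bullet> Df x"
        using x \<eta> le[OF K(1)] K by (intro aligned) auto
      show "0 < Df0 x \<bullet> Dg x" if "g x = \<mu>"
        using inward0[of x] that le[OF K(1)] K x \<eta> \<open>m > 0\<close> by simp
    qed (use \<open>\<gamma> > 0\<close> f(4) in \<open>auto simp: S_def\<close>)
    moreover have "{x \<in> S \<gamma>. f x \<le> 0} = S 0" "{x \<in> S 0 - {0}. f x \<le> - \<gamma>} = S (- \<gamma>)"
      "{x \<in> S \<gamma>. f0 x \<le> \<gamma> - \<eta>} = C" "{x \<in> S (- \<gamma>). f0 x \<le> - \<gamma> - \<eta>} = Y"
      using \<open>\<gamma> > 0\<close> f(4) lower by (auto simp: S_def C_def Y_def N_def)
    ultimately have triv: "\<And>p. trivial_group (relative_homology_group p (top_of_set (S \<gamma>)) (S 0))"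
      "\<And>p. trivial_group (relative_homology_group p (top_of_set (S 0 - {0})) (S (- \<gamma>)))"
      "\<And>p. trivial_group (relative_homology_group p (top_of_set (S \<gamma>)) C)"
      "\<And>p. trivial_group (relative_homology_group p (top_of_set (S (- \<gamma>))) Y)"
      by simp_all
    have sub: "S 0 \<subseteq> S \<gamma>" "S (- \<gamma>) \<subseteq> S 0 - {0}" "S 0 - {0} \<subseteq> S \<gamma>" "S (- \<gamma>) \<subseteq> S \<gamma>"
      "C \<subseteq> S \<gamma>" "Y \<subseteq> S (- \<gamma>)" "Y \<subseteq> C"
      using \<open>\<gamma> > 0\<close> f(4) lower by (auto simp: S_def C_def Y_def N_def)
    let ?H = "\<lambda>A B. relative_homology_group p (top_of_set A) B"
    \<comment> \<open>Each trivial pair changes one entry: the space grows to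
      \<open>S \<gamma>\<close>, the subspace shrinks to \<open>S (- \<gamma>)\<close> and then to
      \<open>Y\<close>, and the space shrinks to \<open>C\<close>.\<close>
    have "?H (S 0) (S 0 - {0}) \<cong> ?H (S \<gamma>) (S 0 - {0})"
      by (rule relative_homology_iso_enlarge_space[OF Diff_subset sub(1) triv(1)])
    also have "?H (S \<gamma>) (S 0 - {0}) \<cong> ?H (S \<gamma>) (S (- \<gamma>))"
      by (rule group.iso_sym[OF group_relative_homology_group
            relative_homology_iso_enlarge_subspace[OF sub(2,3) triv(2)]])
    also have "?H (S \<gamma>) (S (- \<gamma>)) \<cong> ?H (S \<gamma>) Y"
      by (rule group.iso_sym[OF group_relative_homology_group
            relative_homology_iso_enlarge_subspace[OF sub(6,4) triv(4)]])
    also have "?H (S \<gamma>) Y \<cong> ?H C Y"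
      by (rule group.iso_sym[OF group_relative_homology_group
            relative_homology_iso_enlarge_space[OF sub(7,5) triv(3)]])
    finally show ?thesis
      unfolding S0 .
  qed
  have "continuous_on (ball 0 \<rho>) g"
    using g_cont(1) by (rule continuous_on_subset) auto
  then have "open (ball 0 \<rho> \<inter> g -` {..<\<mu>})"
    by (rule continuous_open_preimage) auto
  then have "0 \<in> interior N"
    by (rule interiorI) (use \<open>\<rho> > 0\<close> f0 in \<open>auto simp: N_def g_def \<mu>_def\<close>)
  moreover have "relative_homology_group p (top_of_set ({x. f x \<le> 0} \<inter> N)) ({x. f x \<le> 0} \<inter> N - {0}) \<cong>
      relative_homology_group p (top_of_set ({x. f0 x \<le> 0} \<inter> N)) ({x. f0 x \<le> 0} \<inter> N - {0})"
    if "isolated_critical_on ?K f Df" "\<forall>x\<in>?K. \<bar>f x - f0 x\<bar> \<le> \<eta> \<and> norm (Df x - Df0 x) \<le> \<eta>" for f Df p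
    \<comment> \<open>\<open>key\<close> also applies to \<open>f0\<close> itself, with perturbation
      0.\<close>
    by (rule iso_trans[OF key[OF that(1)] group.iso_sym[OF group_relative_homology_group key[OF crit0]]])
      (use \<eta>(1) that(2) in auto)
  ultimately show ?thesis
    using \<eta>(1) by blast
qed

section \<open>Critical groups of Taylor remainders\<close>

text \<open>The derivative is the inner product with \<open>adjoint f' 1\<close>, and such a vector
  is unique, so \<open>THE\<close> is well defined.\<close>

lemma GDERIV_grad:
  fixes f :: "'a::euclidean_space \<Rightarrow> real"
  assumes "f differentiable (at x)"
  shows "GDERIV f x :> grad f x"
proof -
  obtain f' where f': "(f has_derivative f') (at x)"
    using assms by (auto simp: differentiable_def)
  then have "linear f'"
    by (rule has_derivative_linear)
  then have "f' = (\<lambda>v. v \<bullet> adjoint f' 1)"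
    by (simp add: adjoint_works)
  then have "GDERIV f x :> adjoint f' 1"
    using f' by (simp add: gderiv_def)
  moreover have "D = E" if "GDERIV f x :> D" "GDERIV f x :> E" for D E
    using has_derivative_unique[OF that[unfolded gderiv_def]] by (metis vector_eq_ldot)
  ultimately show ?thesis
    unfolding grad_def by (metis theI)
qed

section \<open>Change of neighbourhood and of base point\<close>

lemma relative_homology_translation:
  fixes A B :: "'a::real_normed_vector set"
  assumes "B \<subseteq> A"
  shows "relative_homology_group p (top_of_set A) B \<cong>
         relative_homology_group p (top_of_set ((+) a ` A)) ((+) a ` B)"
proof (rule is_isoI, rule homeomorphic_map_relative_homology_iso)
  have "homeomorphism A ((+) a ` A) ((+) a) ((+) (- a))"
    by (auto simp: homeomorphism_def image_image intro!: continuous_intros)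
  then show "homeomorphic_map (top_of_set A) (top_of_set ((+) a ` A)) ((+) a)"
    using homeomorphic_map_maps homeomorphic_maps_iff_homeomorphism by blast
qed (use assms in auto)

lemma critical_group_cong_neighbourhood:
  fixes v :: "'a::t1_space \<Rightarrow> real"
  assumes "x \<in> interior U" "x \<in> interior V"
  shows "critical_group k v x U \<cong> critical_group k v x V"
proof -
  let ?H = "\<lambda>U. critical_group k v x U"
  have "?H (U \<inter> V) \<cong> ?H U" "?H (U \<inter> V) \<cong> ?H V"
    unfolding critical_group_def by (rule local_homology_excision; use assms in simp)+
  then show ?thesis
    by (metis critical_group_def group.iso_sym group_relative_homology_group iso_trans)
qed

text \<open>Moves all base points to the origin, so that remainders at different points become
  functions on one common ball.\<close>

lemma critical_group_translation:
  fixes v :: "'a::real_normed_vector \<Rightarrow> real"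
  assumes "x \<in> interior U" "0 \<in> interior N"
  shows "critical_group k v x U \<cong> critical_group k (\<lambda>z. v (x + z)) 0 N"
proof -
  have "x \<in> interior ((+) x ` N)"
    using assms by (force simp: interior_translation)
  then have "critical_group k v x U \<cong> critical_group k v x ((+) x ` N)"
    using assms by (intro critical_group_cong_neighbourhood)
  also have "critical_group k v x ((+) x ` N) \<cong> critical_group k (\<lambda>z. v (x + z)) 0 N"
  proof -
    let ?A = "{z. v (x + z) \<le> v x} \<inter> N"
    have "{y. v y \<le> v x} \<inter> (+) x ` N = (+) x ` ?A"
      by auto
    moreover from this have "{y. v y \<le> v x} \<inter> (+) x ` N - {x} = (+) x ` (?A - {0})"
      by auto
    ultimately show ?thesis
      using group.iso_sym[OF group_relative_homology_group
          relative_homology_translation[of "?A - {0}" ?A "int k" x, OF Diff_subset]]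
      by (simp add: critical_group_def)
  qed
  finally show ?thesis .
qed

lemma critical_group_locally_constant:
  fixes u :: "'a::euclidean_space \<Rightarrow> real"
  assumes "open \<Omega>" "C1_on \<Omega> u" "locally_injective_on \<Omega> (grad u)" and x0: "x0 \<in> \<Omega>"
  shows "\<exists>\<delta>>0. \<forall>y\<in>ball x0 \<delta>. \<forall>k. critical_group k (taylor_remainder u x0) x0 \<Omega> \<cong>
             critical_group k (taylor_remainder u y) y \<Omega>"
proof -
  obtain W where W: "W \<subseteq> \<Omega>" "x0 \<in> interior W" "inj_on (grad u) W"
    using assms by (auto simp: locally_injective_on_def)
  then obtain e where "e > 0" "cball x0 e \<subseteq> W"
    by (metis interior_subset mem_interior_cball)
  \<comment> \<open>Halving leaves room for a shifted base point and a displacement of size at most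
    \<rho> each.\<close>
  define \<rho> where "\<rho> = e / 2"
  have "\<rho> > 0" and ball_W: "cball x0 (2 * \<rho>) \<subseteq> W"
    using \<open>e > 0\<close> \<open>cball x0 e \<subseteq> W\<close> by (auto simp: \<rho>_def)
  have gd: "GDERIV u x :> grad u x" if "x \<in> \<Omega>" for x
    using assms(2) that by (auto simp: C1_on_def intro: GDERIV_grad)
  have cont_grad: "continuous_on \<Omega> (grad u)"
    using assms(2) by (simp add: C1_on_def)
  have cont_u: "continuous_on \<Omega> u"
    using gd by (auto simp: gderiv_def intro!: continuous_at_imp_continuous_on has_derivative_continuous)
  define f where "f y z = taylor_remainder u y (y + z)" for y z
  define Df where "Df y z = grad u (y + z) - grad u y" for y z
  have in_ball: "y + z \<in> cball x0 (2 * \<rho>)" if "y \<in> cball x0 \<rho>" "z \<in> cball 0 \<rho>" for y z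
    using that dist_triangle[of x0 "y + z" y] by (simp add: dist_norm)
  have crit: "isolated_critical_on (cball 0 \<rho>) (f y) (Df y)" if y: "y \<in> cball x0 \<rho>" for y
    unfolding isolated_critical_on_def
  proof (intro conjI ballI impI)
    have sub: "y + z \<in> \<Omega>" if "z \<in> cball 0 \<rho>" for z
      using in_ball[OF y that] ball_W W by auto
    then have img: "(+) y ` cball 0 \<rho> \<subseteq> \<Omega>"
      by blast
    show "continuous_on (cball 0 \<rho>) (f y)"
      unfolding f_def taylor_remainder_def
      by (intro continuous_intros continuous_on_compose2[OF cont_u]) (use img in auto)
    show "continuous_on (cball 0 \<rho>) (Df y)"
      unfolding Df_def
      by (intro continuous_intros continuous_on_compose2[OF cont_grad]) (use img in auto)
    show "GDERIV (f y) z :> Df y z" if "z \<in> interior (cball 0 \<rho>)" for z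
    proof -
      have "(u has_derivative (\<lambda>h. h \<bullet> grad u (y + z))) (at (y + z))"
        using gd[OF sub, of z] that interior_subset by (auto simp: gderiv_def)
      then have "((\<lambda>z. u (y + z)) has_derivative (\<lambda>h. h \<bullet> grad u (y + z))) (at z)"
        by (rule has_derivative_compose[rotated]) (auto intro!: derivative_eq_intros)
      then show ?thesis
        unfolding gderiv_def f_def Df_def taylor_remainder_def
        by (auto intro!: derivative_eq_intros simp: inner_diff_right inner_commute)
    qed
    show "f y 0 = 0" "Df y 0 = 0"
      by (simp_all add: f_def Df_def taylor_remainder_def)
    show "z = 0" if "z \<in> cball 0 \<rho>" "Df y z = 0" for z
    proof -
      \<comment> \<open>A zero of \<open>Df y\<close> means equal gradients at two points of
        \<open>W\<close>, where the gradient is injective.\<close>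
      have "y + z \<in> W" "y + 0 \<in> W"
        using subsetD[OF ball_W in_ball[OF y that(1)]] subsetD[OF ball_W in_ball[OF y, of 0]] \<open>\<rho> > 0\<close>
        by auto
      moreover have "grad u (y + z) = grad u (y + 0)"
        using that(2) by (simp add: Df_def)
      ultimately have "y + z = y + 0"
        using inj_onD[OF W(3)] by blast
      then show ?thesis by simp
    qed
  qed
  have x0_ball: "x0 \<in> cball x0 \<rho>"
    using \<open>\<rho> > 0\<close> by simp
  obtain \<eta> N where "\<eta> > 0" and N: "0 \<in> interior N" and iso:
    "\<forall>g Dg p. isolated_critical_on (cball 0 \<rho>) g Dg \<longrightarrow>
        (\<forall>z\<in>cball 0 \<rho>. \<bar>g z - f x0 z\<bar> \<le> \<eta> \<and> norm (Dg z - Df x0 z) \<le> \<eta>) \<longrightarrow>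
      relative_homology_group p (top_of_set ({z. g z \<le> 0} \<inter> N)) ({z. g z \<le> 0} \<inter> N - {0}) \<cong>
      relative_homology_group p (top_of_set ({z. f x0 z \<le> 0} \<inter> N)) ({z. f x0 z \<le> 0} \<inter> N - {0})"
    using local_critical_homology_stable[OF \<open>\<rho> > 0\<close> crit[OF x0_ball]] by (elim exE conjE)
  \<comment> \<open>The difference of \<open>f y\<close> and \<open>f x0\<close> consists of two
    differences of \<open>u\<close> and one of gradients paired with a vector of norm at most
    \<rho>.\<close>
  define \<epsilon> where "\<epsilon> = \<eta> / (2 + \<rho>)"
  have "\<epsilon> > 0" "\<epsilon> * (2 + \<rho>) = \<eta>"
    using \<open>\<eta> > 0\<close> \<open>\<rho> > 0\<close> by (auto simp: \<epsilon>_def)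
  have uc: "uniformly_continuous_on (cball x0 (2 * \<rho>)) u"
      "uniformly_continuous_on (cball x0 (2 * \<rho>)) (grad u)"
    using ball_W W(1)
    by (auto intro!: compact_uniformly_continuous continuous_on_subset[OF cont_u] continuous_on_subset[OF cont_grad])
  obtain \<delta>1 where \<delta>1: "\<delta>1 > 0" "\<And>x y. \<lbrakk>x \<in> cball x0 (2 * \<rho>); y \<in> cball x0 (2 * \<rho>); dist x y < \<delta>1\<rbrakk> \<Longrightarrow> dist (u x) (u y) < \<epsilon>"
    using uc(1) \<open>\<epsilon> > 0\<close> unfolding uniformly_continuous_on_def by metis
  obtain \<delta>2 where \<delta>2: "\<delta>2 > 0" "\<And>x y. \<lbrakk>x \<in> cball x0 (2 * \<rho>); y \<in> cball x0 (2 * \<rho>); dist x y < \<delta>2\<rbrakk> \<Longrightarrow> dist (grad u x) (grad u y) < \<epsilon>"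
    using uc(2) \<open>\<epsilon> > 0\<close> unfolding uniformly_continuous_on_def by metis
  define \<delta> where "\<delta> = min \<rho> (min \<delta>1 \<delta>2)"
  have "\<delta> > 0"
    using \<open>\<rho> > 0\<close> \<delta>1 \<delta>2 by (simp add: \<delta>_def)
  have group_N: "critical_group k (taylor_remainder u y) y \<Omega> \<cong>
      relative_homology_group (int k) (top_of_set ({x. f y x \<le> 0} \<inter> N)) ({x. f y x \<le> 0} \<inter> N - {0})"
    if "y \<in> \<Omega>" for y k
    using critical_group_translation[of y \<Omega> N k "taylor_remainder u y"] that N assms(1)
    by (simp add: critical_group_def f_def interior_open taylor_remainder_def)
  have "critical_group k (taylor_remainder u x0) x0 \<Omega> \<cong> critical_group k (taylor_remainder u y) y \<Omega>"
    if y: "y \<in> ball x0 \<delta>" for y k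
  proof -
    have y\<rho>: "y \<in> cball x0 \<rho>" and "0 \<in> cball (0::'a) \<rho>"
      using y \<open>\<rho> > 0\<close> by (auto simp: \<delta>_def)
    then have "y \<in> \<Omega>"
      using subsetD[OF ball_W in_ball[of y 0]] W(1) by auto
    have u_close: "\<bar>u (y + z) - u (x0 + z)\<bar> \<le> \<epsilon>" and grad_close: "norm (grad u (y + z) - grad u (x0 + z)) \<le> \<epsilon>"
      if "z \<in> cball 0 \<rho>" for z
      using \<delta>1(2)[OF in_ball[OF y\<rho> that] in_ball[OF x0_ball that]]
        \<delta>2(2)[OF in_ball[OF y\<rho> that] in_ball[OF x0_ball that]] y
      by (auto simp: \<delta>_def dist_real_def dist_norm norm_minus_commute)
    have "relative_homology_group (int k) (top_of_set ({x. f y x \<le> 0} \<inter> N)) ({x. f y x \<le> 0} \<inter> N - {0}) \<cong>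
      relative_homology_group (int k) (top_of_set ({x. f x0 x \<le> 0} \<inter> N)) ({x. f x0 x \<le> 0} \<inter> N - {0})"
    proof (rule iso[rule_format, OF crit[OF y\<rho>]], intro conjI)
      fix z :: 'a assume z: "z \<in> cball 0 \<rho>"
      have "\<bar>(grad u y - grad u x0) \<bullet> z\<bar> \<le> norm (grad u y - grad u x0) * norm z"
        by (rule Cauchy_Schwarz_ineq2)
      also have "\<dots> \<le> \<epsilon> * \<rho>"
        using grad_close[of 0] z \<open>0 \<in> cball (0::'a) \<rho>\<close> \<open>\<epsilon> > 0\<close> by (intro mult_mono) auto
      finally have "\<bar>(grad u y - grad u x0) \<bullet> z\<bar> \<le> \<epsilon> * \<rho>" .
      then have "\<bar>f y z - f x0 z\<bar> \<le> \<epsilon> + \<epsilon> + \<epsilon> * \<rho>"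
        using u_close[OF z] u_close[OF \<open>0 \<in> cball (0::'a) \<rho>\<close>]
        by (simp add: f_def taylor_remainder_def inner_diff_left)
      then show "\<bar>f y z - f x0 z\<bar> \<le> \<eta>"
        using \<open>\<epsilon> * (2 + \<rho>) = \<eta>\<close> by (simp add: algebra_simps)
      have "norm (Df y z - Df x0 z) \<le> norm (grad u (y + z) - grad u (x0 + z)) + norm (grad u y - grad u x0)"
        using norm_triangle_ineq4[of "grad u (y + z) - grad u (x0 + z)" "grad u y - grad u x0"]
        by (simp add: Df_def algebra_simps)
      also have "\<dots> \<le> \<epsilon> + \<epsilon>"
        using grad_close[OF z] grad_close[OF \<open>0 \<in> cball (0::'a) \<rho>\<close>] by simp
      also have "\<dots> \<le> \<eta>"
        using \<open>\<epsilon> * (2 + \<rho>) = \<eta>\<close> mult_pos_pos[OF \<open>\<epsilon> > 0\<close> \<open>\<rho> > 0\<close>] by (simp add: distrib_left)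
      finally show "norm (Df y z - Df x0 z) \<le> \<eta>" .
    qed
    with group_N[OF \<open>y \<in> \<Omega>\<close>] have
      "critical_group k (taylor_remainder u y) y \<Omega> \<cong>
        relative_homology_group (int k) (top_of_set ({x. f x0 x \<le> 0} \<inter> N)) ({x. f x0 x \<le> 0} \<inter> N - {0})"
      by (rule iso_trans)
    from iso_trans[OF group_N[OF x0] group.iso_sym[OF _ this]] show ?thesis
      by (simp add: critical_group_def)
  qed
  with \<open>\<delta> > 0\<close> show ?thesis by blast
qed

theorem theorem5p1:
  fixes \<Omega> :: "(real ^ 'n) set" and u :: "real ^ 'n \<Rightarrow> real"
  assumes "open \<Omega>" and "connected \<Omega>"
    and "C1_on \<Omega> u"
    and "locally_injective_on \<Omega> (grad u)"
  shows "\<forall>k \<le> CARD('n). \<forall>x\<in>\<Omega>. \<forall>y\<in>\<Omega>. \<forall>U V.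
           U \<subseteq> \<Omega> \<and> x \<in> interior U \<and> V \<subseteq> \<Omega> \<and> y \<in> interior V \<longrightarrow>
           critical_group k (taylor_remainder u x) x U \<cong> critical_group k (taylor_remainder u y) y V"
proof (intro allI impI ballI, elim conjE)
  fix k x y U V
  assume xy: "x \<in> \<Omega>" "y \<in> \<Omega>" and UV: "x \<in> interior U" "y \<in> interior V"
  let ?G = "\<lambda>x. critical_group k (taylor_remainder u x) x \<Omega>"
  have grp: "group (critical_group k v z A)" for v and z :: "real ^ 'n" and A
    by (simp add: critical_group_def)
  have "?G x \<cong> ?G y"
  \<comment> \<open>Isomorphism of the critical groups is an equivalence relation on \<Omega> with
    open classes, so connectedness leaves a single class.\<close>
  proof (rule connected_equivalence_relation[OF \<open>connected \<Omega>\<close> xy, where R = "\<lambda>x y. ?G x \<cong> ?G y"])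
    fix x0 assume "x0 \<in> \<Omega>"
    then obtain \<delta> where "\<delta> > 0" "\<forall>y\<in>ball x0 \<delta>. ?G x0 \<cong> ?G y"
      using critical_group_locally_constant[OF assms(1,3,4)] by metis
    then show "\<exists>T. openin (top_of_set \<Omega>) T \<and> x0 \<in> T \<and> (\<forall>y\<in>T. ?G x0 \<cong> ?G y)"
      using \<open>x0 \<in> \<Omega>\<close> by (intro exI[of _ "\<Omega> \<inter> ball x0 \<delta>"]) auto
  qed (use grp group.iso_sym iso_trans in blast)+
  moreover have "critical_group k (taylor_remainder u x) x U \<cong> ?G x" "?G y \<cong> critical_group k (taylor_remainder u y) y V"
    using xy UV \<open>open \<Omega>\<close> by (auto intro!: critical_group_cong_neighbourhood simp: interior_open)
  ultimately show "critical_group k (taylor_remainder u x) x U \<cong> critical_group k (taylor_remainder u y) y V"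
    by (meson iso_trans)
qed

end
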